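(* Suppose $H$ is a flexibly stable countable discrete group with subgroups $A$ and $B$ satisfying the following conditions. (1) If $K \le H$ has finite index, then every $B$-orbit in $H/K$ is contained in an $A$-orbit; explicitly, for every $h \in H$ we have $BhK \subseteq AhK$. (2) If $C$ is the subgroup of $H$ generated by $A$ and $B$, then there is an automorphism $\omega \in \mathrm{Aut}(C)$ such that $\omega(A) = B$ and $\omega^2$ is the identity. (3) There is a constant $\lambda > 1$ such that if $K$ is a proper finite index subgroup of $H$ then for every $g,h \in H$ we have $|AgK| \ge \lambda |BhK|$, where the cardinality $|\cdot|$ is taken in $H/K$ (that is, $|AgK|$ and $|BhK|$ are the numbers of left cosets of $K$ contained in these sets). (4) $A$ has property $(\tau)$ with respect to the family of finite index subgroups $\{K \cap A : K \le H,\ [H:K] < \infty\}$. Then the group $$G = \langle H, t \mid t^2 = 1,\ t a t^{-1} = \omega(a)\ \ \forall a \in A \rangle$$ (the quotient of the free product $H * \langle t \rangle$, with $\langle t\rangle$ infinite cyclic, by the normal closure of $t^2$ and all $t a t^{-1}\omega(a)^{-1}$, $a \in A$) is not sofic.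
   Context: Sofic approximations. Let $G$ be a countable discrete group. A sofic approximation to $G$ consists of a sequence $(V_n)_{n\ge 1}$ of finite sets and a sequence of functions $\sigma_n : G \to \mathrm{Sym}(V_n)$ (written $g \mapsto \sigma_n^g$, not assumed to be homomorphisms) such that: (i) for every $g,h \in G$, $\lim_{n\to\infty} \frac{1}{|V_n|}|\{v \in V_n : \sigma_n^g(\sigma_n^h(v)) = \sigma_n^{gh}(v)\}| = 1$; (ii) for every nontrivial $g \in G$, $\lim_{n\to\infty}\frac{1}{|V_n|}|\{v \in V_n : \sigma_n^g(v) = v\}| = 0$. The group $G$ is sofic if it admits a sofic approximation. A sofic approximation is perfect if every $\sigma_n$ is a group homomorphism. Conjugacy. Two families of maps $(\sigma_n : G \to \mathrm{Sym}(U_n))_n$ and $(\xi_n : G \to \mathrm{Sym}(U_n))_n$ on the same finite sets are at edit-distance zero if for each $g \in G$, $\lim_{n\to\infty}\frac{1}{|U_n|}|\{u \in U_n : \sigma_n^g(u) = \xi_n^g(u)\}| = 1$. Sofic approximations $(\sigma_n : G \to \mathrm{Sym}(V_n))_n$ and $(\xi_n : G \to \mathrm{Sym}(W_n))_n$ are conjugate if there exist finite sets $U_n$ and injections $\pi_n : V_n \to U_n$, $\rho_n : W_n \to U_n$ with $\lim_n |V_n|/|U_n| = \lim_n |W_n|/|U_n| = 1$ such that $(\pi_{n*}\sigma_n)_n$ and $(\rho_{n*}\xi_n)_n$ are at edit-distance zero. Here $\pi_{n*}\sigma_n : G \to \mathrm{Sym}(U_n)$ is given by $(\pi_{n*}\sigma_n)^g(\pi_n(v))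 = \pi_n(\sigma_n^g(v))$ for $v \in V_n$ and $(\pi_{n*}\sigma_n)^g(u) = u$ for $u \in U_n \setminus \pi_n(V_n)$, and $\rho_{n*}\xi_n$ is defined similarly. Flexible stability. A sofic group $G$ is flexibly stable if every sofic approximation to $G$ is conjugate to a perfect sofic approximation to $G$. Property $(\tau)$. For a finite (multi)graph $\Gamma$ with vertex set $V$ and $W \subseteq V$, the edge boundary $\partial_\Gamma W$ is the set of edges with one endpoint in $W$ and the other not in $W$. The edge expansion constant $e(\Gamma)$ is the minimum of $|\partial_\Gamma W|/|W|$ over all nonempty $W \subseteq V$ with $|W| \le \frac12 |V|$ (interpreted as $+\infty$ if there is no such $W$). For $c>0$, a finite connected graph $\Gamma$ is a $c$-expander if $e(\Gamma) \ge c$. For a group $G$, a subgroup $L \le G$ and $S \subseteq G$, the Schreier coset graph $\mathrm{Schreier}(G/L, S)$ is the multigraph with vertex set $G/L$ and edges $\{gL, sgL\}$ for all $gL \in G/L$ and $s \in S$ (multiple edges and self-loops allowed). A group $G$ has property $(\tau)$ with respect to a family $\mathcal{F}$ of finite index subgroups of $G$ if there are a finite generating set $S \subseteq G$ and a constant $c > 0$ such that for every $L \in \mathcal{F}$ the graph $\mathrm{Schreier}(G/L, S)$ is a $c$-expander.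
   Formalization: The group H is additionally assumed to be nontrivial; for H = A = B = 1 all conditions hold (condition (3) vacuously) but G is the group of order two, which is sofic. *)

theory Defs
  imports
    Complex_Main
    "HOL-Library.Extended_Real"
    "HOL-Library.Countable_Set"
    "HOL-Algebra.Bij"
    "HOL-Algebra.Left_Coset"
    "HOL-Algebra.Generated_Groups"
    "HOL-Algebra.Elementary_Groups"
    "Graph_Theory.Digraph_Component"
begin

section \<open>Sofic approximations\<close>

text \<open>
  A sequence of finite sets \<open>V n\<close> with maps \<open>\<sigma> n\<close> from the group to \<open>Sym (V n)\<close>, the latter being
  \<^const>\<open>BijGroup\<close>, whose elements are extensional functions on \<open>V n\<close>. The sequence is indexed by
  all natural numbers. Since \<open>x / 0 = 0\<close>, the first limit (for \<open>g = h = \<one>\<close>) forces \<open>V n\<close> to be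
  nonempty for all large \<open>n\<close>, so finitely many empty sets are harmless.
\<close>

definition sofic_approximation ::
  "('g, 'm) monoid_scheme \<Rightarrow> (nat \<Rightarrow> 'v set) \<Rightarrow> (nat \<Rightarrow> 'g \<Rightarrow> 'v \<Rightarrow> 'v) \<Rightarrow> bool" where
  "sofic_approximation G V \<sigma> \<longleftrightarrow>
     (\<forall>n. finite (V n)) \<and>
     (\<forall>n. \<forall>g\<in>carrier G. \<sigma> n g \<in> carrier (BijGroup (V n))) \<and>
     (\<forall>g\<in>carrier G. \<forall>h\<in>carrier G.
        (\<lambda>n. real (card {v \<in> V n. \<sigma> n g (\<sigma> n h v) = \<sigma> n (g \<otimes>\<^bsub>G\<^esub> h) v}) / real (card (V n)))
          \<longlonglongrightarrow> 1) \<and>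
     (\<forall>g\<in>carrier G. g \<noteq> \<one>\<^bsub>G\<^esub> \<longrightarrow>
        (\<lambda>n. real (card {v \<in> V n. \<sigma> n g v = v}) / real (card (V n))) \<longlonglongrightarrow> 0)"

definition perfect_sofic_approximation ::
  "('g, 'm) monoid_scheme \<Rightarrow> (nat \<Rightarrow> 'v set) \<Rightarrow> (nat \<Rightarrow> 'g \<Rightarrow> 'v \<Rightarrow> 'v) \<Rightarrow> bool" where
  "perfect_sofic_approximation G V \<sigma> \<longleftrightarrow>
     sofic_approximation G V \<sigma> \<and> (\<forall>n. \<sigma> n \<in> hom G (BijGroup (V n)))"

definition edit_distance_zero ::
  "('g, 'm) monoid_scheme \<Rightarrow> (nat \<Rightarrow> 'u set) \<Rightarrow>
     (nat \<Rightarrow> 'g \<Rightarrow> 'u \<Rightarrow> 'u) \<Rightarrow> (nat \<Rightarrow> 'g \<Rightarrow> 'u \<Rightarrow> 'u) \<Rightarrow> bool" where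
  "edit_distance_zero G U \<sigma> \<xi> \<longleftrightarrow>
     (\<forall>g\<in>carrier G.
        (\<lambda>n. real (card {u \<in> U n. \<sigma> n g u = \<xi> n g u}) / real (card (U n))) \<longlonglongrightarrow> 1)"

text \<open>The push-forward of a family of permutations of \<open>V\<close> along an injection \<open>p\<close> of \<open>V\<close> into \<open>U\<close>.\<close>

definition push_forward ::
  "'v set \<Rightarrow> 'u set \<Rightarrow> ('v \<Rightarrow> 'u) \<Rightarrow> ('g \<Rightarrow> 'v \<Rightarrow> 'v) \<Rightarrow> 'g \<Rightarrow> 'u \<Rightarrow> 'u" where
  "push_forward V U p \<sigma> g = (\<lambda>u\<in>U. if u \<in> p ` V then p (\<sigma> g (inv_into V p u)) else u)"

text \<open>
  Definitions cannot quantify over types, so here and below the finite sets whose existence is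
  asserted, or over which one quantifies, are sets of natural numbers; every finite set is in
  bijection with one of these.
\<close>

definition conjugate ::
  "('g, 'm) monoid_scheme \<Rightarrow> (nat \<Rightarrow> 'v set) \<Rightarrow> (nat \<Rightarrow> 'g \<Rightarrow> 'v \<Rightarrow> 'v) \<Rightarrow>
     (nat \<Rightarrow> 'w set) \<Rightarrow> (nat \<Rightarrow> 'g \<Rightarrow> 'w \<Rightarrow> 'w) \<Rightarrow> bool" where
  "conjugate G V \<sigma> W \<xi> \<longleftrightarrow>
     (\<exists>(U :: nat \<Rightarrow> nat set) p r.
        (\<forall>n. finite (U n)) \<and>
        (\<forall>n. inj_on (p n) (V n) \<and> p n ` V n \<subseteq> U n) \<and>
        (\<forall>n. inj_on (r n) (W n) \<and> r n ` W n \<subseteq> U n) \<and>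
        (\<lambda>n. real (card (V n)) / real (card (U n))) \<longlonglongrightarrow> 1 \<and>
        (\<lambda>n. real (card (W n)) / real (card (U n))) \<longlonglongrightarrow> 1 \<and>
        edit_distance_zero G U
          (\<lambda>n. push_forward (V n) (U n) (p n) (\<sigma> n))
          (\<lambda>n. push_forward (W n) (U n) (r n) (\<xi> n)))"

definition sofic :: "('g, 'm) monoid_scheme \<Rightarrow> bool" where
  "sofic G \<longleftrightarrow> (\<exists>(V :: nat \<Rightarrow> nat set) \<sigma>. sofic_approximation G V \<sigma>)"

definition flexibly_stable :: "('g, 'm) monoid_scheme \<Rightarrow> bool" where
  "flexibly_stable G \<longleftrightarrow>
     sofic G \<and>
     (\<forall>(V :: nat \<Rightarrow> nat set) \<sigma>. sofic_approximation G V \<sigma> \<longrightarrow>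
        (\<exists>(W :: nat \<Rightarrow> nat set) \<xi>. perfect_sofic_approximation G W \<xi> \<and> conjugate G V \<sigma> W \<xi>))"


section \<open>Property tau\<close>

text \<open>
  A finite multigraph is given by a \<^typ>\<open>('v, 'e) pre_digraph\<close> whose arcs are read as undirected
  edges, the orientation being irrelevant; accordingly \<^const>\<open>Digraph_Component.connected\<close> is
  connectedness of the underlying undirected graph.
\<close>

definition edge_boundary :: "('v, 'e) pre_digraph \<Rightarrow> 'v set \<Rightarrow> 'e set" where
  "edge_boundary \<Gamma> W = {e \<in> arcs \<Gamma>. (tail \<Gamma> e \<in> W) \<noteq> (head \<Gamma> e \<in> W)}"

text \<open>The infimum in the extended reals of the empty set is \<open>\<infinity>\<close>.\<close>

definition edge_expansion :: "('v, 'e) pre_digraph \<Rightarrow> ereal" where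
  "edge_expansion \<Gamma> =
     (INF W \<in> {W. W \<subseteq> verts \<Gamma> \<and> W \<noteq> {} \<and> real (card W) \<le> real (card (verts \<Gamma>)) / 2}.
        ereal (real (card (edge_boundary \<Gamma> W)) / real (card W)))"

definition expander :: "real \<Rightarrow> ('v, 'e) pre_digraph \<Rightarrow> bool" where
  "expander c \<Gamma> \<longleftrightarrow>
     fin_digraph \<Gamma> \<and> Digraph_Component.connected \<Gamma> \<and> ereal c \<le> edge_expansion \<Gamma>"

text \<open>The pair \<open>(X, s)\<close> is the edge joining the left coset \<open>X\<close> to \<open>sX\<close>.\<close>

definition Schreier :: "('g, 'm) monoid_scheme \<Rightarrow> 'g set \<Rightarrow> 'g set \<Rightarrow> ('g set, 'g set \<times> 'g) pre_digraph"
  where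
  "Schreier G L S =
     \<lparr>verts = lcosets\<^bsub>G\<^esub> L, arcs = (lcosets\<^bsub>G\<^esub> L) \<times> S,
      tail = (\<lambda>(X, s). X), head = (\<lambda>(X, s). s <#\<^bsub>G\<^esub> X)\<rparr>"

definition property_tau :: "('g, 'm) monoid_scheme \<Rightarrow> 'g set set \<Rightarrow> bool" where
  "property_tau G F \<longleftrightarrow>
     (\<exists>S c. finite S \<and> S \<subseteq> carrier G \<and> generate G S = carrier G \<and> c > 0 \<and>
        (\<forall>L\<in>F. expander c (Schreier G L S)))"

definition finite_index_subgroup :: "'g set \<Rightarrow> ('g, 'm) monoid_scheme \<Rightarrow> bool" where
  "finite_index_subgroup K G \<longleftrightarrow> subgroup K G \<and> finite (lcosets\<^bsub>G\<^esub> K)"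


section \<open>Free products\<close>

text \<open>
  Elements of the free product are words in the disjoint union of the two carriers, modulo deleting
  identity letters and multiplying adjacent letters from the same factor.
\<close>

abbreviation fp_words :: "('a, 'm) monoid_scheme \<Rightarrow> ('b, 'n) monoid_scheme \<Rightarrow> ('a + 'b) list set" where
  "fp_words G H \<equiv> lists (carrier G <+> carrier H)"

inductive_set fp_rel ::
  "('a, 'm) monoid_scheme \<Rightarrow> ('b, 'n) monoid_scheme \<Rightarrow> (('a + 'b) list \<times> ('a + 'b) list) set"
  for G H where
  refl: "w \<in> fp_words G H \<Longrightarrow> (w, w) \<in> fp_rel G H"
| sym: "(v, w) \<in> fp_rel G H \<Longrightarrow> (w, v) \<in> fp_rel G H"
| trans: "(u, v) \<in> fp_rel G H \<Longrightarrow> (v, w) \<in> fp_rel G H \<Longrightarrow> (u, w) \<in> fp_rel G H"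
| one_left: "u \<in> fp_words G H \<Longrightarrow> v \<in> fp_words G H \<Longrightarrow>
    (u @ [Inl \<one>\<^bsub>G\<^esub>] @ v, u @ v) \<in> fp_rel G H"
| one_right: "u \<in> fp_words G H \<Longrightarrow> v \<in> fp_words G H \<Longrightarrow>
    (u @ [Inr \<one>\<^bsub>H\<^esub>] @ v, u @ v) \<in> fp_rel G H"
| mult_left: "u \<in> fp_words G H \<Longrightarrow> v \<in> fp_words G H \<Longrightarrow> x \<in> carrier G \<Longrightarrow> y \<in> carrier G \<Longrightarrow>
    (u @ [Inl x, Inl y] @ v, u @ [Inl (x \<otimes>\<^bsub>G\<^esub> y)] @ v) \<in> fp_rel G H"
| mult_right: "u \<in> fp_words G H \<Longrightarrow> v \<in> fp_words G H \<Longrightarrow> x \<in> carrier H \<Longrightarrow> y \<in> carrier H \<Longrightarrow>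
    (u @ [Inr x, Inr y] @ v, u @ [Inr (x \<otimes>\<^bsub>H\<^esub> y)] @ v) \<in> fp_rel G H"

definition free_product ::
  "('a, 'm) monoid_scheme \<Rightarrow> ('b, 'n) monoid_scheme \<Rightarrow> ('a + 'b) list set monoid" where
  "free_product G H =
     \<lparr>carrier = fp_words G H // fp_rel G H,
      monoid.mult = (\<lambda>X Y. \<Union>u\<in>X. \<Union>v\<in>Y. fp_rel G H `` {u @ v}),
      one = fp_rel G H `` {[]}\<rparr>"

definition fp_inl :: "('a, 'm) monoid_scheme \<Rightarrow> ('b, 'n) monoid_scheme \<Rightarrow> 'a \<Rightarrow> ('a + 'b) list set" where
  "fp_inl G H x = fp_rel G H `` {[Inl x]}"

definition fp_inr :: "('a, 'm) monoid_scheme \<Rightarrow> ('b, 'n) monoid_scheme \<Rightarrow> 'b \<Rightarrow> ('a + 'b) list set" where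
  "fp_inr G H y = fp_rel G H `` {[Inr y]}"

lemma fp_rel_words:
  assumes "group G" "group H" "(u, v) \<in> fp_rel G H"
  shows "u \<in> fp_words G H \<and> v \<in> fp_words G H"
proof -
  interpret G: group G by fact
  interpret H: group H by fact
  show ?thesis
    using assms(3) by induction auto
qed

lemma equiv_fp_rel:
  assumes "group G" "group H"
  shows "equiv (fp_words G H) (fp_rel G H)"
proof (rule equivI)
  show "fp_rel G H \<subseteq> fp_words G H \<times> fp_words G H"
    using fp_rel_words[OF assms] by auto
  show "refl_on (fp_words G H) (fp_rel G H)"
    by (intro refl_onI fp_rel.refl)
  show "Relation.sym (fp_rel G H)"
    by (rule symI) (rule fp_rel.sym)
  show "Relation.trans (fp_rel G H)"
    by (rule transI) (rule fp_rel.trans)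
qed

lemma fp_rel_append_left:
  assumes "(u, v) \<in> fp_rel G H" "w \<in> fp_words G H"
  shows "(w @ u, w @ v) \<in> fp_rel G H"
  using assms
proof induction
  case (refl u)
  then show ?case by (intro fp_rel.refl) auto
next
  case (sym u v)
  then show ?case by (metis fp_rel.sym)
next
  case (trans u v x)
  then show ?case by (metis fp_rel.trans)
next
  case (one_left u v)
  then show ?case using fp_rel.one_left[of "w @ u" G H v] by auto
next
  case (one_right u v)
  then show ?case using fp_rel.one_right[of "w @ u" G H v] by auto
next
  case (mult_left u v x y)
  then show ?case using fp_rel.mult_left[of "w @ u" G H v x y] by auto
next
  case (mult_right u v x y)
  then show ?case using fp_rel.mult_right[of "w @ u" G H v x y] by auto
qed

lemma fp_rel_append_right:
  assumes "(u, v) \<in> fp_rel G H" "w \<in> fp_words G H"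
  shows "(u @ w, v @ w) \<in> fp_rel G H"
  using assms
proof induction
  case (refl u)
  then show ?case by (intro fp_rel.refl) auto
next
  case (sym u v)
  then show ?case by (metis fp_rel.sym)
next
  case (trans u v x)
  then show ?case by (metis fp_rel.trans)
next
  case (one_left u v)
  then show ?case using fp_rel.one_left[of u G H "v @ w"] by auto
next
  case (one_right u v)
  then show ?case using fp_rel.one_right[of u G H "v @ w"] by auto
next
  case (mult_left u v x y)
  then show ?case using fp_rel.mult_left[of u G H "v @ w" x y] by auto
next
  case (mult_right u v x y)
  then show ?case using fp_rel.mult_right[of u G H "v @ w" x y] by auto
qed

lemma fp_mult_class:
  assumes "group G" "group H" "u \<in> fp_words G H" "v \<in> fp_words G H"
  shows "fp_rel G H `` {u} \<otimes>\<^bsub>free_product G H\<^esub> fp_rel G H `` {v} = fp_rel G H `` {u @ v}"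
proof -
  have *: "fp_rel G H `` {u' @ v'} = fp_rel G H `` {u @ v}"
    if "(u, u') \<in> fp_rel G H" "(v, v') \<in> fp_rel G H" for u' v'
  proof -
    have "u' \<in> fp_words G H"
      using fp_rel_words[OF assms(1,2) that(1)] by simp
    then have "(u @ v, u' @ v') \<in> fp_rel G H"
      by (rule fp_rel.trans[OF fp_rel_append_right[OF that(1) assms(4)] fp_rel_append_left[OF that(2)]])
    then show ?thesis
      using equiv_class_eq[OF equiv_fp_rel[OF assms(1,2)]] by metis
  qed
  have "(\<Union>u'\<in>fp_rel G H `` {u}. \<Union>v'\<in>fp_rel G H `` {v}. fp_rel G H `` {u' @ v'}) =
        (\<Union>u'\<in>fp_rel G H `` {u}. \<Union>v'\<in>fp_rel G H `` {v}. fp_rel G H `` {u @ v})"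
    using * by (intro SUP_cong) auto
  also have "\<dots> = fp_rel G H `` {u @ v}"
    using fp_rel.refl[OF assms(3)] fp_rel.refl[OF assms(4)] by auto
  finally show ?thesis
    by (simp add: free_product_def)
qed

lemma fp_left_inverse:
  assumes "group G" "group H" "w \<in> fp_words G H"
  shows "\<exists>v\<in>fp_words G H. (v @ w, []) \<in> fp_rel G H"
proof -
  interpret G: group G by fact
  interpret H: group H by fact
  show ?thesis
    using assms(3)
  proof (induction w)
    case Nil
    then show ?case by (auto intro: fp_rel.refl)
  next
    case (Cons a w)
    then obtain v where v: "v \<in> fp_words G H" "(v @ w, []) \<in> fp_rel G H"
      by auto
    have w: "w \<in> fp_words G H" and a: "a \<in> carrier G <+> carrier H"
      using Cons.hyps by auto
    obtain b where b: "b \<in> carrier G <+> carrier H" "(v @ [b, a] @ w, v @ w) \<in> fp_rel G H"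
    proof (cases a)
      case (Inl x)
      then have x: "x \<in> carrier G" using a by auto
      show ?thesis
        using x Inl fp_rel.trans[OF fp_rel.mult_left[of v G H w "inv\<^bsub>G\<^esub> x" x]] fp_rel.one_left[of v G H w] v w
        by (intro that[of "Inl (inv\<^bsub>G\<^esub> x)"]) auto
    next
      case (Inr x)
      then have x: "x \<in> carrier H" using a by auto
      show ?thesis
        using x Inr fp_rel.trans[OF fp_rel.mult_right[of v G H w "inv\<^bsub>H\<^esub> x" x]] fp_rel.one_right[of v G H w] v w
        by (intro that[of "Inr (inv\<^bsub>H\<^esub> x)"]) auto
    qed
    have "((v @ [b]) @ a # w, []) \<in> fp_rel G H"
      using fp_rel.trans[OF b(2) v(2)] by simp
    moreover have "v @ [b] \<in> fp_words G H"
      using v b by auto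
    ultimately show ?case by blast
  qed
qed

lemma group_free_product:
  assumes "group G" "group H"
  shows "group (free_product G H)"
proof (rule groupI)
  let ?P = "free_product G H" and ?R = "fp_rel G H"
  have carr: "carrier ?P = fp_words G H // ?R" and one: "\<one>\<^bsub>?P\<^esub> = ?R `` {[]}"
    by (simp_all add: free_product_def)
  note m = fp_mult_class[OF assms]
  show "\<one>\<^bsub>?P\<^esub> \<in> carrier ?P"
    unfolding carr one by (intro quotientI) auto
  fix X assume X: "X \<in> carrier ?P"
  then obtain u where u: "u \<in> fp_words G H" "X = ?R `` {u}"
    unfolding carr quotient_def by blast
  show "\<one>\<^bsub>?P\<^esub> \<otimes>\<^bsub>?P\<^esub> X = X"
    unfolding one u(2) using m[of "[]" u] u(1) by simp
  show "\<exists>Y\<in>carrier ?P. Y \<otimes>\<^bsub>?P\<^esub> X = \<one>\<^bsub>?P\<^esub>"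
  proof -
    obtain v where v: "v \<in> fp_words G H" "(v @ u, []) \<in> ?R"
      using fp_left_inverse[OF assms u(1)] by blast
    then have "?R `` {v} \<otimes>\<^bsub>?P\<^esub> X = \<one>\<^bsub>?P\<^esub>"
      unfolding u(2) m[OF v(1) u(1)] one
      using equiv_class_eq[OF equiv_fp_rel[OF assms]] by metis
    moreover have "?R `` {v} \<in> carrier ?P"
      unfolding carr using v by (intro quotientI)
    ultimately show ?thesis by blast
  qed
  fix Y assume Y: "Y \<in> carrier ?P"
  then obtain v where v: "v \<in> fp_words G H" "Y = ?R `` {v}"
    unfolding carr quotient_def by blast
  have uv: "u @ v \<in> fp_words G H" using u v by auto
  show "X \<otimes>\<^bsub>?P\<^esub> Y \<in> carrier ?P"
    unfolding u(2) v(2) m[OF u(1) v(1)] carr using uv by (rule quotientI)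
  fix Z assume Z: "Z \<in> carrier ?P"
  then obtain w where w: "w \<in> fp_words G H" "Z = ?R `` {w}"
    unfolding carr quotient_def by blast
  have vw: "v @ w \<in> fp_words G H" using v w by auto
  show "X \<otimes>\<^bsub>?P\<^esub> Y \<otimes>\<^bsub>?P\<^esub> Z = X \<otimes>\<^bsub>?P\<^esub> (Y \<otimes>\<^bsub>?P\<^esub> Z)"
    unfolding u(2) v(2) w(2) m[OF u(1) v(1)] m[OF v(1) w(1)] m[OF uv w(1)] m[OF u(1) vw] by simp
qed

lemma hom_fp_inl:
  assumes "group G" "group H"
  shows "fp_inl G H \<in> hom G (free_product G H)"
proof (rule homI)
  fix x assume x: "x \<in> carrier G"
  show "fp_inl G H x \<in> carrier (free_product G H)"
    unfolding fp_inl_def free_product_def using x by (auto intro: quotientI)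
  fix y assume y: "y \<in> carrier G"
  have "([Inl x, Inl y], [Inl (x \<otimes>\<^bsub>G\<^esub> y)]) \<in> fp_rel G H"
    using fp_rel.mult_left[of "[]" G H "[]" x y] x y by simp
  then show "fp_inl G H (x \<otimes>\<^bsub>G\<^esub> y) = fp_inl G H x \<otimes>\<^bsub>free_product G H\<^esub> fp_inl G H y"
    unfolding fp_inl_def using x y fp_mult_class[OF assms, of "[Inl x]" "[Inl y]"]
      equiv_class_eq[OF equiv_fp_rel[OF assms]] by fastforce
qed

lemma hom_fp_inr:
  assumes "group G" "group H"
  shows "fp_inr G H \<in> hom H (free_product G H)"
proof (rule homI)
  fix x assume x: "x \<in> carrier H"
  show "fp_inr G H x \<in> carrier (free_product G H)"
    unfolding fp_inr_def free_product_def using x by (auto intro: quotientI)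
  fix y assume y: "y \<in> carrier H"
  have "([Inr x, Inr y], [Inr (x \<otimes>\<^bsub>H\<^esub> y)]) \<in> fp_rel G H"
    using fp_rel.mult_right[of "[]" G H "[]" x y] x y by simp
  then show "fp_inr G H (x \<otimes>\<^bsub>H\<^esub> y) = fp_inr G H x \<otimes>\<^bsub>free_product G H\<^esub> fp_inr G H y"
    unfolding fp_inr_def using x y fp_mult_class[OF assms, of "[Inr x]" "[Inr y]"]
      equiv_class_eq[OF equiv_fp_rel[OF assms]] by fastforce
qed


section \<open>The group obtained by adjoining an involution\<close>

definition normal_closure :: "('a, 'm) monoid_scheme \<Rightarrow> 'a set \<Rightarrow> 'a set" where
  "normal_closure G R = \<Inter>{N. N \<lhd> G \<and> R \<subseteq> N}"

lemma normal_normal_closure: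
  assumes "group G" "R \<subseteq> carrier G"
  shows "normal_closure G R \<lhd> G"
proof -
  interpret group G by fact
  have ne: "carrier G \<in> {N. N \<lhd> G \<and> R \<subseteq> N}"
    using assms(2) by (auto simp: normal_inv_iff subgroup_self)
  have "subgroup (normal_closure G R) G"
    unfolding normal_closure_def using ne
    by (intro subgroups_Inter) (auto intro: normal_imp_subgroup)
  then show ?thesis
    unfolding normal_inv_iff by (auto simp: normal_closure_def normal_inv_iff)
qed

text \<open>
  \<open>\<langle>H, t | t\<^sup>2 = 1, t a t\<^sup>-\<^sup>1 = \<omega>(a) for all a \<in> A\<rangle>\<close>, where \<open>t\<close> is the generator \<open>1\<close> of the infinite
  cyclic group \<^const>\<open>integer_group\<close>.
\<close>

definition adjoin_relators ::
  "('a, 'm) monoid_scheme \<Rightarrow> 'a set \<Rightarrow> ('a \<Rightarrow> 'a) \<Rightarrow> ('a + int) list set set" where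
  "adjoin_relators H A \<omega> =
     (let P = free_product H integer_group;
          i = fp_inl H integer_group;
          t = fp_inr H integer_group 1
      in insert (t \<otimes>\<^bsub>P\<^esub> t)
           {t \<otimes>\<^bsub>P\<^esub> i a \<otimes>\<^bsub>P\<^esub> inv\<^bsub>P\<^esub> t \<otimes>\<^bsub>P\<^esub> inv\<^bsub>P\<^esub> (i (\<omega> a)) | a. a \<in> A})"

definition adjoin_involution ::
  "('a, 'm) monoid_scheme \<Rightarrow> 'a set \<Rightarrow> ('a \<Rightarrow> 'a) \<Rightarrow> ('a + int) list set set monoid" where
  "adjoin_involution H A \<omega> =
     (let P = free_product H integer_group in P Mod normal_closure P (adjoin_relators H A \<omega>))"

lemma group_adjoin_involution:
  assumes "group H" "A \<subseteq> carrier H" "\<omega> ` A \<subseteq> carrier H"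
  shows "group (adjoin_involution H A \<omega>)"
proof -
  let ?P = "free_product H integer_group"
  interpret P: group ?P
    using assms(1) by (intro group_free_product) auto
  have i: "fp_inl H integer_group x \<in> carrier ?P" if "x \<in> carrier H" for x
    using hom_fp_inl[OF assms(1) group_integer_group] that by (auto simp: hom_def)
  have t: "fp_inr H integer_group 1 \<in> carrier ?P"
    using hom_fp_inr[OF assms(1) group_integer_group] by (auto simp: hom_def)
  have "adjoin_relators H A \<omega> \<subseteq> carrier ?P"
    using assms(2,3) i t by (auto simp: adjoin_relators_def Let_def image_subset_iff subset_iff)
  then show ?thesis
    unfolding adjoin_involution_def Let_def
    by (intro normal.factorgroup_is_group normal_normal_closure P.group_axioms)
qed

end

theory Submission
  imports Defs "HOL-Algebra.Group_Action"
begin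

text \<open>
  \<open>H\<close> embeds into \<open>G\<close>, because \<open>G\<close> acts on the set \<open>H\<close>: \<open>H\<close> by left translation and \<open>t\<close> by
  twisting the right cosets of \<open>C\<close> with \<open>\<omega>\<close>. Hence a sofic approximation of \<open>G\<close> gives one of \<open>H\<close>,
  which by flexible stability may be replaced by genuine actions of \<open>H\<close> on finite sets \<open>U n\<close>,
  together with a permutation \<open>\<tau>\<close> of \<open>U n\<close> that is almost everywhere an involution and almost
  everywhere intertwines \<open>a\<close> with \<open>\<omega>(a)\<close>. The \<open>A\<close>-orbits are expanders, and few of their edges
  are mapped by \<open>\<tau>\<close> to pairs in different \<open>B\<close>-orbits. So for most \<open>x\<close> the \<open>B\<close>-orbit of \<open>\<tau> x\<close>
  has more than \<open>1/\<lambda>\<close> times as many points as the \<open>A\<close>-orbit of \<open>x\<close>, and then the \<open>A\<close>-orbit of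
  \<open>\<tau> x\<close> is strictly larger than that of \<open>x\<close>. Applying this to \<open>x\<close> and to \<open>\<tau> x\<close> contradicts
  \<open>\<tau> (\<tau> x) = x\<close>.
\<close>

section \<open>Partitions of expanders\<close>

text \<open>Double counting: a pair \<open>(y, s)\<close> crosses the level set of \<open>k\<close>
  only if \<open>k\<close> is \<open>f y\<close> or \<open>f (act s y)\<close>, so the boundaries of
  all level sets together use each label-changing edge at most twice.\<close>

lemma sum_card_crossing_le:
  fixes f :: "'u \<Rightarrow> 'k" and act :: "'s \<Rightarrow> 'u \<Rightarrow> 'u"
  assumes "finite U" "finite S" "finite K"
  shows "(\<Sum>k\<in>K. card {(y, s) \<in> U \<times> S. (f y = k) \<noteq> (f (act s y) = k)})
    \<le> 2 * card {(y, s) \<in> U \<times> S. f y \<noteq> f (act s y)}"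
proof -
  let ?E = "{(y, s) \<in> U \<times> S. f y \<noteq> f (act s y)}"
  define R where "R k e = (case e of (y, s) \<Rightarrow> (f y = k) \<noteq> (f (act s y) = k))" for k e
  have fin: "finite ?E"
    using assms by (auto intro: finite_subset[of _ "U \<times> S"])
  have "(\<Sum>k\<in>K. card {(y, s) \<in> U \<times> S. (f y = k) \<noteq> (f (act s y) = k)}) = (\<Sum>k\<in>K. card {e \<in> ?E. R k e})"
    by (intro sum.cong refl arg_cong[where f = card]) (auto simp: R_def)
  also have "\<dots> = (\<Sum>e\<in>?E. card {k \<in> K. R k e})"
    using assms(3) fin by (intro sum_multicount_gen) auto
  also have "\<dots> \<le> (\<Sum>e\<in>?E. 2)"
  proof (rule sum_mono)
    fix e :: "'u \<times> 's"
    obtain y s where e: "e = (y, s)" by force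
    have "{k \<in> K. R k e} \<subseteq> {f y, f (act s y)}"
      by (auto simp: R_def e)
    then have "card {k \<in> K. R k e} \<le> card {f y, f (act s y)}"
      by (intro card_mono) auto
    also have "\<dots> \<le> 2"
      by (simp add: card_insert_if)
    finally show "card {k \<in> K. R k e} \<le> 2" .
  qed
  finally show ?thesis by simp
qed

text \<open>Each label class inside one orbit that meets \<open>D\<close> has edge boundary at least
  \<open>c * (1 - 1 / l)\<close> times its size. Every boundary edge changes the label and is shared
  by at most two classes, so few label changes force \<open>D\<close> to be small.\<close>

lemma expander_cells:
  fixes orb :: "'u \<Rightarrow> 'u set" and L :: "'u \<Rightarrow> 'b" and act :: "'s \<Rightarrow> 'u \<Rightarrow> 'u" and c l :: real
  assumes fin: "finite U" "finite S"
    and act: "\<And>x s. x \<in> U \<Longrightarrow> s \<in> S \<Longrightarrow> act s x \<in> U \<and> orb (act s x) = orb x"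
    and orb: "\<And>x. x \<in> U \<Longrightarrow> orb x = {y \<in> U. orb y = orb x}"
    and expansion: "\<And>x X. x \<in> U \<Longrightarrow> X \<subseteq> orb x \<Longrightarrow> 2 * card X \<le> card (orb x) \<Longrightarrow>
      c * card X \<le> card {(y, s) \<in> orb x \<times> S. (y \<in> X) \<noteq> (act s y \<in> X)}"
    and "c > 0" "l > 1" "D \<subseteq> U"
    and small: "\<And>x. x \<in> D \<Longrightarrow> l * card {y \<in> orb x. L y = L x} \<le> card (orb x)"
  shows "c * (1 - 1 / l) * card D \<le> 2 * card {(y, s) \<in> U \<times> S. L y \<noteq> L (act s y)}"
proof -
  \<comment> \<open>Pairing \<open>L\<close> with \<open>orb\<close> makes the cells the label
    classes within single orbits, where the expansion hypothesis applies.\<close>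
  define f where "f x = (orb x, L x)" for x
  define cell where "cell k = {y \<in> U. f y = k}" for k
  define bd where "bd k = {(y, s) \<in> U \<times> S. (f y = k) \<noteq> (f (act s y) = k)}" for k
  have q: "0 < 1 - 1 / l" "1 - 1 / l \<le> 1" using \<open>l > 1\<close> by auto
  have cell_le: "c * (1 - 1 / l) * card (cell (f x)) \<le> card (bd (f x))" if "x \<in> D" for x
  proof -
    have x: "x \<in> U" using that \<open>D \<subseteq> U\<close> by auto
    have mem_orb: "y \<in> orb x \<longleftrightarrow> y \<in> U \<and> orb y = orb x" for y
      by (subst orb[OF x]) simp
    have cell: "cell (f x) = {y \<in> orb x. L y = L x}"
      by (auto simp: cell_def f_def mem_orb)
    have orb_U: "orb x \<subseteq> U" using mem_orb by blast
    then have orb_fin: "finite (orb x)" using fin(1) by (rule finite_subset)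
    have orb_act: "act s y \<in> orb x" if "y \<in> orb x" "s \<in> S" for y s
      using that act[of y s] by (simp add: mem_orb)
    let ?X = "cell (f x)"
    let ?b = "{(y, s) \<in> orb x \<times> S. (y \<in> ?X) \<noteq> (act s y \<in> ?X)}"
    have X: "?X \<subseteq> orb x" unfolding cell by blast
    have "finite (bd (f x))"
      unfolding bd_def using fin by (auto intro: finite_subset[of _ "U \<times> S"])
    moreover have "?b \<subseteq> bd (f x)"
      using orb_U orb_act by (auto simp: bd_def cell_def)
    ultimately have b_le: "card ?b \<le> card (bd (f x))"
      by (rule card_mono)
    have "(1 - 1 / l) * (c * card ?X) \<le> card ?b"
    proof (cases "2 * card ?X \<le> card (orb x)")
      case True
      have "(1 - 1 / l) * (c * card ?X) \<le> 1 * (c * card ?X)"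
        using q \<open>c > 0\<close> by (intro mult_right_mono) auto
      also have "\<dots> \<le> card ?b"
        using expansion[OF x X True] by simp
      finally show ?thesis .
    next
      case False
      \<comment> \<open>A cell of more than half the orbit is handled through its complement, which
        has the same edge boundary and, by \<open>small\<close>, contains at least the fraction
        \<open>1 - 1 / l\<close> of the orbit.\<close>
      let ?Y = "orb x - ?X"
      have card_Y: "card ?Y = card (orb x) - card ?X"
        using X orb_fin by (intro card_Diff_subset) (auto intro: finite_subset)
      have card_X: "card ?X \<le> card (orb x)"
        using X orb_fin by (rule card_mono[rotated])
      have "{(y, s) \<in> orb x \<times> S. (y \<in> ?Y) \<noteq> (act s y \<in> ?Y)} = ?b"
        using orb_act by auto
      then have Y: "c * card ?Y \<le> card ?b"
        using expansion[OF x, of ?Y] False card_Y by auto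
      have "card ?X \<le> (1 / l) * card (orb x)"
        using small[OF that] \<open>l > 1\<close> by (simp add: cell field_simps)
      then have "(1 - 1 / l) * card (orb x) \<le> card ?Y"
        using card_Y card_X by (simp add: of_nat_diff algebra_simps)
      moreover have "(1 - 1 / l) * card ?X \<le> (1 - 1 / l) * card (orb x)"
        using q card_X by (intro mult_left_mono) auto
      ultimately have "c * ((1 - 1 / l) * card ?X) \<le> c * card ?Y"
        using \<open>c > 0\<close> by (intro mult_left_mono) auto
      with Y show ?thesis by (simp add: algebra_simps)
    qed
    with b_le show ?thesis by (simp add: mult.commute mult.left_commute)
  qed
  have finD: "finite D" using \<open>D \<subseteq> U\<close> fin(1) by (rule finite_subset)
  have "D \<subseteq> (\<Union>k\<in>f ` D. cell k)"
    using \<open>D \<subseteq> U\<close> by (auto simp: cell_def)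
  then have "card D \<le> card (\<Union>k\<in>f ` D. cell k)"
    using finD fin by (intro card_mono) (auto simp: cell_def)
  also have "\<dots> \<le> (\<Sum>k\<in>f ` D. card (cell k))"
    using finD by (intro card_UN_le) auto
  finally have "real (card D) \<le> (\<Sum>k\<in>f ` D. real (card (cell k)))"
    using of_nat_mono by fastforce
  then have "c * (1 - 1 / l) * card D \<le> (\<Sum>k\<in>f ` D. c * (1 - 1 / l) * card (cell k))"
    unfolding sum_distrib_left[symmetric] using q \<open>c > 0\<close> by (intro mult_left_mono) auto
  also have "\<dots> \<le> (\<Sum>k\<in>f ` D. card (bd k))"
    unfolding of_nat_sum using cell_le by (intro sum_mono) auto
  also have "\<dots> \<le> real (2 * card {(y, s) \<in> U \<times> S. f y \<noteq> f (act s y)})"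
    unfolding bd_def using sum_card_crossing_le[OF fin, of "f ` D" f act] finD
    by (intro of_nat_mono) auto
  \<comment> \<open>The action preserves \<open>orb\<close>, so along an edge \<open>f\<close>
    changes exactly when \<open>L\<close> does.\<close>
  also have "{(y, s) \<in> U \<times> S. f y \<noteq> f (act s y)} = {(y, s) \<in> U \<times> S. L y \<noteq> L (act s y)}"
    using act by (auto simp: f_def)
  finally show ?thesis by simp
qed


section \<open>Orbits and coset graphs\<close>

context group_action
begin

lemma transporter_eq_l_coset:
  assumes "x \<in> E" "g \<in> carrier G"
  shows "{h \<in> carrier G. \<phi> h x = \<phi> g x} = g <#\<^bsub>G\<^esub> stabilizer G \<phi> x"
proof -
  interpret group G using group_hom group_hom.axioms(1) by auto
  show ?thesis
  proof (intro subset_antisym subsetI)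
    fix h assume "h \<in> {h \<in> carrier G. \<phi> h x = \<phi> g x}"
    then have h: "h \<in> carrier G" "\<phi> h x = \<phi> g x" by auto
    then have "\<phi> (inv g \<otimes> h) x = x"
      using assms composition_rule orbit_sym_aux by simp
    then have "inv g \<otimes> h \<in> stabilizer G \<phi> x"
      using h assms by (auto simp: stabilizer_def)
    moreover have "h = g \<otimes> (inv g \<otimes> h)"
      using h assms by (simp add: m_assoc[symmetric])
    ultimately show "h \<in> g <#\<^bsub>G\<^esub> stabilizer G \<phi> x"
      unfolding l_coset_def by blast
  next
    fix h assume "h \<in> g <#\<^bsub>G\<^esub> stabilizer G \<phi> x"
    then show "h \<in> {h \<in> carrier G. \<phi> h x = \<phi> g x}"
      using assms composition_rule by (auto simp: l_coset_def stabilizer_def)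
  qed
qed

lemma inj_on_transporter: "inj_on (\<lambda>y. {h \<in> carrier G. \<phi> h x = y}) (orbit G \<phi> x)"
  by (rule inj_onI) (auto simp: orbit_def)

text \<open>Orbit-stabilizer with an explicit map: a point corresponds to the set of group elements
  carrying \<open>x\<close> to it. This is the dictionary between orbit points and vertices of a
  coset graph.\<close>

lemma bij_betw_orbit_lcosets:
  assumes "x \<in> E"
  shows "bij_betw (\<lambda>y. {h \<in> carrier G. \<phi> h x = y}) (orbit G \<phi> x) (lcosets (stabilizer G \<phi> x))"
proof -
  have "(\<lambda>y. {h \<in> carrier G. \<phi> h x = y}) ` orbit G \<phi> x = lcosets (stabilizer G \<phi> x)"
    unfolding orbit_def LCOSETS_def
    using transporter_eq_l_coset[OF assms] by (auto simp: image_iff)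
  then show ?thesis
    using inj_on_transporter by (simp add: bij_betw_def)
qed

lemma orbit_subset: "x \<in> E \<Longrightarrow> orbit G \<phi> x \<subseteq> E"
  using element_image by (auto simp: orbit_def)

lemma orbit_eqI:
  assumes "x \<in> E" "y \<in> orbit G \<phi> x"
  shows "orbit G \<phi> y = orbit G \<phi> x"
proof -
  have y: "y \<in> E" using assms orbit_subset by auto
  have "x \<in> orbit G \<phi> y" using orbit_sym assms y by auto
  then show ?thesis
    using orbit_trans[OF assms(1) y] orbit_trans[OF y assms(1)] assms y orbit_subset by blast
qed

lemma orbit_eq_Collect:
  assumes "x \<in> E"
  shows "orbit G \<phi> x = {y \<in> E. orbit G \<phi> y = orbit G \<phi> x}"
  using orbit_eqI[OF assms] orbit_subset[OF assms] orbit_refl by blast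

text \<open>Through point stabilizers, hypotheses about finite index subgroups become statements
  about all finite actions; the index is the length of the orbit.\<close>

lemma finite_index_stabilizer:
  assumes "finite E" "x \<in> E"
  shows "finite_index_subgroup (stabilizer G \<phi> x) G"
  unfolding finite_index_subgroup_def
  using stabilizer_subgroup[OF assms(2)] bij_betw_finite[OF bij_betw_orbit_lcosets[OF assms(2)]]
    finite_subset[OF orbit_subset[OF assms(2)] assms(1)] by simp

text \<open>The orbit-coset dictionary is equivariant: the edge labelled \<open>s\<close> leaving
  the coset of \<open>y\<close> ends at the coset of \<open>\<phi> s y\<close>.\<close>

lemma l_coset_transporter:
  assumes "x \<in> E" "s \<in> carrier G" "y \<in> orbit G \<phi> x"
  shows "s <#\<^bsub>G\<^esub> {h \<in> carrier G. \<phi> h x = y} = {h \<in> carrier G. \<phi> h x = \<phi> s y}"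
proof -
  interpret group G using group_hom group_hom.axioms(1) by auto
  obtain g where g: "g \<in> carrier G" "y = \<phi> g x" using assms(3) by (auto simp: orbit_def)
  have "\<phi> s y = \<phi> (s \<otimes> g) x"
    using g assms composition_rule by simp
  moreover have "stabilizer G \<phi> x \<subseteq> carrier G" by (auto simp: stabilizer_def)
  ultimately show ?thesis
    using transporter_eq_l_coset[OF assms(1)] g assms lcos_m_assoc by simp
qed

text \<open>The Schreier graph of the stabilizer is a copy of the orbit with the edges
  \<open>(y, s)\<close>, loops and multiplicities included, so its expansion bound can be read off
  on subsets of the orbit.\<close>

lemma expander_orbit:
  assumes "x \<in> E" "finite E" "S \<subseteq> carrier G"
    and "expander c (Schreier G (stabilizer G \<phi> x) S)"
    and X: "X \<subseteq> orbit G \<phi> x" "2 * card X \<le> card (orbit G \<phi> x)"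
  shows "c * card X \<le> card {(y, s) \<in> orbit G \<phi> x \<times> S. (y \<in> X) \<noteq> (\<phi> s y \<in> X)}"
proof (cases "X = {}")
  case False
  define T where "T y = {h \<in> carrier G. \<phi> h x = y}" for y
  let ?O = "orbit G \<phi> x"
  let ?\<Gamma> = "Schreier G (stabilizer G \<phi> x) S"
  note bij = bij_betw_orbit_lcosets[OF assms(1), folded T_def]
  have inj: "inj_on T ?O" using bij by (simp add: bij_betw_def)
  have im: "T ` ?O = verts ?\<Gamma>" using bij by (simp add: bij_betw_def Schreier_def)
  have card_verts: "card (verts ?\<Gamma>) = card ?O" using inj im card_image by metis
  have "finite X" using finite_subset[OF X(1)] finite_subset[OF orbit_subset[OF assms(1)] assms(2)] by simp
  have card_TX: "card (T ` X) = card X"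
    using inj X(1) by (meson card_image inj_on_subset)
  have mem: "T y \<in> T ` X \<longleftrightarrow> y \<in> X" if "y \<in> ?O" for y
    using that inj X(1) by (meson inj_on_image_mem_iff)
  have orb_act: "\<phi> s y \<in> ?O" if "y \<in> ?O" "s \<in> S" for y s
  proof -
    interpret group G using group_hom group_hom.axioms(1) by auto
    from that(1) obtain g where g: "g \<in> carrier G" "y = \<phi> g x" by (auto simp: orbit_def)
    have s: "s \<in> carrier G" using that(2) assms(3) by auto
    have "\<phi> s y = \<phi> (s \<otimes> g) x" using composition_rule[OF assms(1) s g(1)] g(2) by simp
    then show ?thesis using s g(1) by (auto simp: orbit_def)
  qed
  have head: "s <#\<^bsub>G\<^esub> T y = T (\<phi> s y)" if "y \<in> ?O" "s \<in> S" for y s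
    unfolding T_def using l_coset_transporter[OF assms(1) _ that(1), of s] assms(3) that(2) by auto
  have image_Collect: "{(Y, s) \<in> T ` ?O \<times> S. P Y s} = (\<lambda>(y, s). (T y, s)) ` {(y, s) \<in> ?O \<times> S. P (T y) s}" for P
    by force
  have crossing: "(T y \<in> T ` X) \<noteq> (s <#\<^bsub>G\<^esub> T y \<in> T ` X) \<longleftrightarrow> (y \<in> X) \<noteq> (\<phi> s y \<in> X)" if "y \<in> ?O" "s \<in> S" for y s
    unfolding head[OF that] mem[OF that(1)] mem[OF orb_act[OF that]] ..
  have "edge_boundary ?\<Gamma> (T ` X) = (\<lambda>(y, s). (T y, s)) ` {(y, s) \<in> ?O \<times> S. (y \<in> X) \<noteq> (\<phi> s y \<in> X)}"
  proof -
    have "edge_boundary ?\<Gamma> (T ` X) = {(Y, s) \<in> (T ` ?O) \<times> S. (Y \<in> T ` X) \<noteq> (s <#\<^bsub>G\<^esub> Y \<in> T ` X)}"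
      unfolding im by (auto simp: edge_boundary_def Schreier_def)
    also have "\<dots> = (\<lambda>(y, s). (T y, s)) ` {(y, s) \<in> ?O \<times> S. (T y \<in> T ` X) \<noteq> (s <#\<^bsub>G\<^esub> T y \<in> T ` X)}"
      by (rule image_Collect)
    moreover have "(y, s) \<in> ?O \<times> S \<and> (T y \<in> T ` X) \<noteq> (s <#\<^bsub>G\<^esub> T y \<in> T ` X)
        \<longleftrightarrow> (y, s) \<in> ?O \<times> S \<and> (y \<in> X) \<noteq> (\<phi> s y \<in> X)" for y s
      using crossing[of y s] by blast
    then have "{(y, s) \<in> ?O \<times> S. (T y \<in> T ` X) \<noteq> (s <#\<^bsub>G\<^esub> T y \<in> T ` X)}
        = {(y, s) \<in> ?O \<times> S. (y \<in> X) \<noteq> (\<phi> s y \<in> X)}"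
      by (simp only:)
    ultimately show ?thesis by (simp only:)
  qed
  moreover have "inj_on (\<lambda>(y, s). (T y, s)) {(y, s) \<in> ?O \<times> S. (y \<in> X) \<noteq> (\<phi> s y \<in> X)}"
    using inj by (auto simp: inj_on_def)
  ultimately have card_bd: "card (edge_boundary ?\<Gamma> (T ` X))
      = card {(y, s) \<in> ?O \<times> S. (y \<in> X) \<noteq> (\<phi> s y \<in> X)}"
    by (simp add: card_image)
  have "ereal c \<le> edge_expansion ?\<Gamma>"
    using assms(4) by (simp add: expander_def)
  \<comment> \<open>The image of \<open>X\<close> is nonempty and has at most half of the vertices,
    so it takes part in the infimum.\<close>
  also have "\<dots> \<le> ereal (real (card (edge_boundary ?\<Gamma> (T ` X))) / real (card (T ` X)))"
    unfolding edge_expansion_def using X False im card_verts card_TX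
    by (intro INF_lower) auto
  finally have "c \<le> real (card (edge_boundary ?\<Gamma> (T ` X))) / real (card (T ` X))"
    by simp
  moreover have "card X > 0" using False \<open>finite X\<close> by (simp add: card_gt_0_iff)
  ultimately show ?thesis
    using card_bd card_TX by (simp add: field_simps)
qed simp

text \<open>For the stabilizer \<open>K\<close> of \<open>x\<close>, the cosets of \<open>K\<close>
  inside \<open>AK\<close> are the \<open>aK\<close> with \<open>a\<close> in \<open>A\<close>, and
  these correspond to the points of the \<open>A\<close>-orbit of \<open>x\<close>. Thus coset
  counts become orbit lengths.\<close>

lemma card_lcosets_eq_card_orbit:
  assumes "x \<in> E" "subgroup A G"
  shows "card {X \<in> lcosets (stabilizer G \<phi> x). X \<subseteq> A <#> (\<one> <#\<^bsub>G\<^esub> stabilizer G \<phi> x)}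
    = card (orbit (G\<lparr>carrier := A\<rparr>) \<phi> x)"
proof -
  interpret group G using group_hom group_hom.axioms(1) by auto
  let ?K = "stabilizer G \<phi> x"
  define T where "T y = {h \<in> carrier G. \<phi> h x = y}" for y
  note A = subgroup.subset[OF assms(2)]
  have K: "?K \<subseteq> carrier G" by (auto simp: stabilizer_def)
  have T: "T (\<phi> g x) = g <#\<^bsub>G\<^esub> ?K" if "g \<in> carrier G" for g
    unfolding T_def using transporter_eq_l_coset[OF assms(1) that] .
  have "A <#> (\<one> <#\<^bsub>G\<^esub> ?K) = (\<Union>a\<in>A. a <#\<^bsub>G\<^esub> ?K)"
    using K by (simp add: lcos_mult_one) (auto simp: set_mult_def l_coset_def)
  then have "{X \<in> lcosets ?K. X \<subseteq> A <#> (\<one> <#\<^bsub>G\<^esub> ?K)} = {X \<in> lcosets ?K. X \<subseteq> (\<Union>a\<in>A. a <#\<^bsub>G\<^esub> ?K)}"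
    by simp
  also have "\<dots> = T ` orbit (G\<lparr>carrier := A\<rparr>) \<phi> x"
  proof (intro subset_antisym subsetI)
    fix X assume "X \<in> {X \<in> lcosets ?K. X \<subseteq> (\<Union>a\<in>A. a <#\<^bsub>G\<^esub> ?K)}"
    then obtain g where g: "g \<in> carrier G" "X = g <#\<^bsub>G\<^esub> ?K" "X \<subseteq> (\<Union>a\<in>A. a <#\<^bsub>G\<^esub> ?K)"
      by (auto simp: LCOSETS_def)
    have "g \<in> X" using g stabilizer_subgroup[OF assms(1)] lcos_self by simp
    \<comment> \<open>The coset \<open>X\<close> shares \<open>g\<close> with some
      \<open>aK\<close>, so both belong to the same orbit point and coincide.\<close>
    then obtain a where a: "a \<in> A" "g \<in> a <#\<^bsub>G\<^esub> ?K" using g by auto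
    then have "g \<in> T (\<phi> a x)" using T A by auto
    then have "\<phi> g x = \<phi> a x" by (simp add: T_def)
    then have "X = T (\<phi> a x)" using g(1,2) T[OF g(1)] by simp
    then show "X \<in> T ` orbit (G\<lparr>carrier := A\<rparr>) \<phi> x"
      using a by (auto simp: orbit_def)
  next
    fix X assume "X \<in> T ` orbit (G\<lparr>carrier := A\<rparr>) \<phi> x"
    then obtain a where a: "a \<in> A" "X = a <#\<^bsub>G\<^esub> ?K"
      using T A by (auto simp: orbit_def)
    then show "X \<in> {X \<in> lcosets ?K. X \<subseteq> (\<Union>a\<in>A. a <#\<^bsub>G\<^esub> ?K)}"
      using A by (auto simp: LCOSETS_def)
  qed
  finally have "{X \<in> lcosets ?K. X \<subseteq> A <#> (\<one> <#\<^bsub>G\<^esub> ?K)} = T ` orbit (G\<lparr>carrier := A\<rparr>) \<phi> x" .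
  moreover have "inj_on T (orbit (G\<lparr>carrier := A\<rparr>) \<phi> x)"
    unfolding T_def using A by (intro inj_on_subset[OF inj_on_transporter]) (auto simp: orbit_def)
  ultimately show ?thesis
    by (simp add: card_image)
qed

end

section \<open>Orbit growth under an approximate intertwiner\<close>

text \<open>Label \<open>x\<close> by the \<open>B\<close>-orbit of \<open>\<tau> x\<close> and
  apply \<open>expander_cells\<close> to the \<open>A\<close>-orbits. The label can change along
  \<open>(y, s)\<close> only where intertwining fails at \<open>y\<close>. If the
  \<open>A\<close>-orbit does not get longer from \<open>x\<close> to \<open>\<tau> x\<close>, then
  \<open>growth\<close> bounds the \<open>B\<close>-orbit of \<open>\<tau> x\<close>, and with it
  the label class of \<open>x\<close>, by the fraction \<open>1 / l\<close> of the
  \<open>A\<close>-orbit of \<open>x\<close>.\<close>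

lemma card_not_growing_le:
  fixes H (structure) and c l :: real
  assumes "group_action H U \<phi>" and fin: "finite U" "finite S"
    and A: "subgroup A H" and B: "subgroup B H" and S: "S \<subseteq> A" "\<omega> ` S \<subseteq> B" and "c > 0" "l > 1"
    and expander: "\<And>K. finite_index_subgroup K H \<Longrightarrow> expander c (Schreier (H\<lparr>carrier := A\<rparr>) (K \<inter> A) S)"
    and growth: "\<And>K. finite_index_subgroup K H \<Longrightarrow> K \<noteq> carrier H \<Longrightarrow>
      l * card {X \<in> lcosets K. X \<subseteq> B <#> (\<one> <#\<^bsub>H\<^esub> K)} \<le> card {X \<in> lcosets K. X \<subseteq> A <#> (\<one> <#\<^bsub>H\<^esub> K)}"
    and \<tau>: "inj_on \<tau> U" "\<tau> ` U \<subseteq> U"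
  defines "orb \<equiv> orbit (H\<lparr>carrier := A\<rparr>) \<phi>"
  shows "c * (1 - 1 / l) *
      card {x \<in> U. \<not> card (orb x) < card (orb (\<tau> x)) \<and> (\<exists>h\<in>carrier H. \<phi> h (\<tau> x) \<noteq> \<tau> x)}
    \<le> 2 * (card S * card {x \<in> U. \<not> (\<forall>s\<in>S. \<tau> (\<phi> s x) = \<phi> (\<omega> s) (\<tau> x))})"
proof -
  interpret group_action H U \<phi> by fact
  interpret A: group_action "H\<lparr>carrier := A\<rparr>" U \<phi> by (rule induced_action[OF A])
  interpret B: group_action "H\<lparr>carrier := B\<rparr>" U \<phi> by (rule induced_action[OF B])
  define L where "L x = orbit (H\<lparr>carrier := B\<rparr>) \<phi> (\<tau> x)" for x
  define D where "D = {x \<in> U. \<not> card (orb x) < card (orb (\<tau> x)) \<and> (\<exists>h\<in>carrier H. \<phi> h (\<tau> x) \<noteq> \<tau> x)}"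
  let ?bad = "{x \<in> U. \<not> (\<forall>s\<in>S. \<tau> (\<phi> s x) = \<phi> (\<omega> s) (\<tau> x))}"
  have in_orb: "\<phi> s x \<in> orb x" if "s \<in> S" for s x
    using that S(1) by (auto simp: orb_def orbit_def)
  have "c * (1 - 1 / l) * card D \<le> 2 * card {(y, s) \<in> U \<times> S. L y \<noteq> L (\<phi> s y)}"
  proof (rule expander_cells[where orb = orb])
    fix x s assume "x \<in> U" "s \<in> S"
    then show "\<phi> s x \<in> U \<and> orb (\<phi> s x) = orb x"
      using in_orb A.orbit_subset A.orbit_eqI unfolding orb_def by blast
  next
    fix x assume x: "x \<in> U"
    show "orb x = {y \<in> U. orb y = orb x}"
      unfolding orb_def by (rule A.orbit_eq_Collect[OF x])
    fix X assume X: "X \<subseteq> orb x" "2 * card X \<le> card (orb x)"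
    \<comment> \<open>Stabilizers in \<open>A\<close> are the traces on \<open>A\<close> of
      stabilizers in \<open>H\<close>, which is the family for which expansion is assumed.\<close>
    have "stabilizer (H\<lparr>carrier := A\<rparr>) \<phi> x = stabilizer H \<phi> x \<inter> A"
      using subgroup.subset[OF A] by (auto simp: stabilizer_def)
    then have "expander c (Schreier (H\<lparr>carrier := A\<rparr>) (stabilizer (H\<lparr>carrier := A\<rparr>) \<phi> x) S)"
      using expander[OF finite_index_stabilizer[OF fin(1) x]] by simp
    then show "c * card X \<le> card {(y, s) \<in> orb x \<times> S. (y \<in> X) \<noteq> (\<phi> s y \<in> X)}"
      using A.expander_orbit[OF x fin(1), of S c X] S(1) X unfolding orb_def by simp
  next
    fix x assume "x \<in> D"
    then have x: "x \<in> U" "card (orb (\<tau> x)) \<le> card (orb x)" "\<exists>h\<in>carrier H. \<phi> h (\<tau> x) \<noteq> \<tau> x"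
      by (auto simp: D_def)
    have \<tau>x: "\<tau> x \<in> U" using x \<tau> by auto
    \<comment> \<open>A point moved by some element has a proper stabilizer, the case to which
      \<open>growth\<close> applies.\<close>
    have "stabilizer H \<phi> (\<tau> x) \<noteq> carrier H" using x(3) by (auto simp: stabilizer_def)
    then have "l * card (L x) \<le> card (orb (\<tau> x))"
      using growth[OF finite_index_stabilizer[OF fin(1) \<tau>x]]
      unfolding card_lcosets_eq_card_orbit[OF \<tau>x A] card_lcosets_eq_card_orbit[OF \<tau>x B] L_def orb_def by simp
    \<comment> \<open>The map \<open>\<tau>\<close> sends the points of the \<open>A\<close>-orbit
      that share the label of \<open>x\<close> injectively into one \<open>B\<close>-orbit.\<close>
    moreover have "card {y \<in> orb x. L y = L x} \<le> card (L x)"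
    proof (rule card_inj_on_le)
      have sub: "{y \<in> orb x. L y = L x} \<subseteq> U"
        using A.orbit_subset[OF x(1)] by (auto simp: orb_def)
      show "inj_on \<tau> {y \<in> orb x. L y = L x}" using inj_on_subset[OF \<tau>(1) sub] .
      show "\<tau> ` {y \<in> orb x. L y = L x} \<subseteq> L x"
      proof clarify
        fix y assume y: "y \<in> orb x" "L y = L x"
        then have "\<tau> y \<in> U" using sub \<tau>(2) by auto
        then have "\<tau> y \<in> L y" unfolding L_def by (rule B.orbit_refl)
        then show "\<tau> y \<in> L x" using y by simp
      qed
      show "finite (L x)"
        using finite_subset[OF B.orbit_subset[OF \<tau>x] fin(1)] by (simp add: L_def)
    qed
    then have "l * card {y \<in> orb x. L y = L x} \<le> l * card (L x)"
      using \<open>l > 1\<close> by (intro mult_left_mono) auto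
    ultimately show "l * card {y \<in> orb x. L y = L x} \<le> card (orb x)"
      using x(2) by linarith
  qed (use fin \<open>c > 0\<close> \<open>l > 1\<close> in \<open>auto simp: D_def\<close>)
  also have "\<dots> \<le> real (2 * (card S * card ?bad))"
  proof -
    have "{(y, s) \<in> U \<times> S. L y \<noteq> L (\<phi> s y)} \<subseteq> ?bad \<times> S"
    proof clarify
      fix y s assume ys: "y \<in> U" "s \<in> S" "L y \<noteq> L (\<phi> s y)" "\<forall>s\<in>S. \<tau> (\<phi> s y) = \<phi> (\<omega> s) (\<tau> y)"
      have "\<tau> y \<in> U" using ys(1) \<tau> by auto
      moreover have "\<phi> (\<omega> s) (\<tau> y) \<in> orbit (H\<lparr>carrier := B\<rparr>) \<phi> (\<tau> y)"
        using S(2) ys(2) by (auto simp: orbit_def)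
      ultimately have "L (\<phi> s y) = L y"
        unfolding L_def using ys(2,4) B.orbit_eqI by simp
      then show False using ys(3) by simp
    qed
    then have "card {(y, s) \<in> U \<times> S. L y \<noteq> L (\<phi> s y)} \<le> card (?bad \<times> S)"
      using fin by (intro card_mono) auto
    then have "card {(y, s) \<in> U \<times> S. L y \<noteq> L (\<phi> s y)} \<le> card S * card ?bad"
      by (simp only: card_cartesian_product mult.commute)
    then show ?thesis by (intro of_nat_mono mult_left_mono) auto
  qed
  finally show ?thesis by (simp add: D_def)
qed


section \<open>Sets of asymptotic density one\<close>

text \<open>The strict inequality fails when \<open>card (U n)\<close> is 0, so the notion includes
  that \<open>U n\<close> is eventually nonempty; for the constant predicate \<open>True\<close> and
  finite sets it says exactly that.\<close>

definition almost_all :: "(nat \<Rightarrow> 'u set) \<Rightarrow> (nat \<Rightarrow> 'u \<Rightarrow> bool) \<Rightarrow> bool" where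
  "almost_all U P \<longleftrightarrow> (\<forall>e>0. \<forall>\<^sub>F n in sequentially. real (card {u \<in> U n. \<not> P n u}) < e * real (card (U n)))"

lemma almost_all_density_one:
  assumes fin: "\<And>n. finite (U n)"
    and lim: "(\<lambda>n. real (card {u \<in> U n. P n u}) / real (card (U n))) \<longlonglongrightarrow> 1"
  shows "almost_all U P"
  unfolding almost_all_def
proof (intro allI impI)
  fix e :: real assume "e > 0"
  \<comment> \<open>The \<open>max 0\<close> makes the ratio positive, which excludes empty
    \<open>U n\<close>, where division by zero would give 0.\<close>
  from lim have "\<forall>\<^sub>F n in sequentially. max 0 (1 - e) < real (card {u \<in> U n. P n u}) / real (card (U n))"
    using \<open>e > 0\<close> by (intro order_tendstoD) auto
  then show "\<forall>\<^sub>F n in sequentially. real (card {u \<in> U n. \<not> P n u}) < e * real (card (U n))"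
  proof (rule eventually_mono)
    fix n assume *: "max 0 (1 - e) < real (card {u \<in> U n. P n u}) / real (card (U n))"
    then have pos: "card (U n) > 0" by (cases "card (U n) = 0") auto
    have "card (U n) = card {u \<in> U n. P n u} + card {u \<in> U n. \<not> P n u}"
      using fin[of n] card_Un_disjoint[of "{u \<in> U n. P n u}" "{u \<in> U n. \<not> P n u}"]
      by (auto simp: Collect_disj_eq[symmetric] conj_disj_distribL[symmetric])
    then show "real (card {u \<in> U n. \<not> P n u}) < e * real (card (U n))"
      using * pos by (simp add: field_simps)
  qed
qed

text \<open>A vanishing ratio is no evidence of nonemptiness, because \<open>0 / 0 = 0\<close>;
  hence the separate hypothesis \<open>ne\<close>.\<close>

lemma almost_all_density_zero:
  assumes ne: "almost_all U (\<lambda>_ _. True)"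
    and lim: "(\<lambda>n. real (card {u \<in> U n. P n u}) / real (card (U n))) \<longlonglongrightarrow> 0"
  shows "almost_all U (\<lambda>n u. \<not> P n u)"
  unfolding almost_all_def
proof (intro allI impI)
  fix e :: real assume "e > 0"
  with lim have "\<forall>\<^sub>F n in sequentially. real (card {u \<in> U n. P n u}) / real (card (U n)) < e"
    by (rule order_tendstoD)
  moreover have "\<forall>\<^sub>F n in sequentially. 0 < real (card (U n))"
    using ne[unfolded almost_all_def, rule_format, of 1] by simp
  ultimately show "\<forall>\<^sub>F n in sequentially. real (card {u \<in> U n. \<not> \<not> P n u}) < e * real (card (U n))"
    by eventually_elim (simp add: field_simps)
qed

lemma almost_all_nonempty:
  assumes "almost_all U P"
  shows "\<exists>n. \<exists>u\<in>U n. P n u"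
proof -
  from assms have "\<forall>\<^sub>F n in sequentially. real (card {u \<in> U n. \<not> P n u}) < real (card (U n))"
    using almost_all_def[of U P] by (auto dest: spec[of _ 1])
  then obtain n where n: "real (card {u \<in> U n. \<not> P n u}) < real (card (U n))"
    using eventually_happens[of _ sequentially] by auto
  then have "{u \<in> U n. \<not> P n u} \<noteq> U n" by (intro notI) simp
  then show ?thesis by blast
qed

text \<open>Density one survives when the exceptional set grows by at most a fixed factor. This form
  accepts counting bounds such as the expander estimate.\<close>

lemma almost_all_card_le:
  fixes C :: real
  assumes "almost_all U P"
    and le: "\<And>n. real (card {u \<in> U n. \<not> Q n u}) \<le> C * real (card {u \<in> U n. \<not> P n u})"
  shows "almost_all U Q"
  unfolding almost_all_def
proof (intro allI impI)
  fix e :: real assume "e > 0"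
  \<comment> \<open>As \<open>C\<close> may be zero or negative, \<open>e\<close> is divided by a
    positive majorant of it.\<close>
  define C' where "C' = max C 1"
  have C': "C' > 0" "C \<le> C'" by (auto simp: C'_def)
  from assms(1) \<open>e > 0\<close> C'(1)
  have "\<forall>\<^sub>F n in sequentially. real (card {u \<in> U n. \<not> P n u}) < e / C' * real (card (U n))"
    unfolding almost_all_def by (meson divide_pos_pos)
  then show "\<forall>\<^sub>F n in sequentially. real (card {u \<in> U n. \<not> Q n u}) < e * real (card (U n))"
  proof eventually_elim
    case (elim n)
    have "real (card {u \<in> U n. \<not> Q n u}) \<le> C' * real (card {u \<in> U n. \<not> P n u})"
      using le[of n] C'(2) by (meson mult_right_mono of_nat_0_le_iff order_trans)
    also have "\<dots> < e * real (card (U n))"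
      using elim C'(1) by (simp add: field_simps)
    finally show ?case .
  qed
qed

lemma almost_all_mono:
  assumes "\<And>n. finite (U n)" "almost_all U P" "\<And>n u. u \<in> U n \<Longrightarrow> P n u \<Longrightarrow> Q n u"
  shows "almost_all U Q"
proof (rule almost_all_card_le[OF assms(2), of _ 1])
  show "real (card {u \<in> U n. \<not> Q n u}) \<le> 1 * real (card {u \<in> U n. \<not> P n u})" for n
    using assms(1)[of n] assms(3)[of _ n] by (auto intro!: card_mono)
qed

lemma almost_all_conj:
  assumes fin: "\<And>n. finite (U n)" and PQ: "almost_all U P" "almost_all U Q"
  shows "almost_all U (\<lambda>n u. P n u \<and> Q n u)"
  unfolding almost_all_def
proof (intro allI impI)
  fix e :: real assume "e > 0"
  then have "e / 2 > 0" by simp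
  note ev = PQ[unfolded almost_all_def, rule_format, OF this]
  from ev show "\<forall>\<^sub>F n in sequentially. real (card {u \<in> U n. \<not> (P n u \<and> Q n u)}) < e * real (card (U n))"
  proof eventually_elim
    case (elim n)
    have "{u \<in> U n. \<not> (P n u \<and> Q n u)} = {u \<in> U n. \<not> P n u} \<union> {u \<in> U n. \<not> Q n u}" by auto
    then have "card {u \<in> U n. \<not> (P n u \<and> Q n u)} \<le> card {u \<in> U n. \<not> P n u} + card {u \<in> U n. \<not> Q n u}"
      by (simp add: card_Un_le)
    then show ?case using elim by linarith
  qed
qed

lemma almost_all_Ball:
  assumes "\<And>n. finite (U n)" "almost_all U (\<lambda>_ _. True)" "finite S" "\<And>s. s \<in> S \<Longrightarrow> almost_all U (P s)"
  shows "almost_all U (\<lambda>n u. \<forall>s\<in>S. P s n u)"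
  using assms(3,4)
proof (induction S)
  case empty
  then show ?case using assms(2) by simp
next
  case (insert s S)
  have "almost_all U (P s)" "almost_all U (\<lambda>n u. \<forall>s\<in>S. P s n u)"
    using insert.prems insert.IH by auto
  from almost_all_conj[OF assms(1) this] show ?case by simp
qed

text \<open>The points whose image is exceptional are mapped injectively into the exceptional set of
  \<open>P\<close>, so they are no more numerous.\<close>

lemma almost_all_inj:
  assumes fin: "\<And>n. finite (U n)" and P: "almost_all U P"
    and f: "\<And>n. inj_on (f n) (U n)" "\<And>n. f n ` U n \<subseteq> U n"
  shows "almost_all U (\<lambda>n u. P n (f n u))"
proof (rule almost_all_card_le[OF P, of _ 1])
  fix n
  have "card {u \<in> U n. \<not> P n (f n u)} \<le> card {u \<in> U n. \<not> P n u}"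
  proof (rule card_inj_on_le)
    show "inj_on (f n) {u \<in> U n. \<not> P n (f n u)}"
      using f(1)[of n] by (rule inj_on_subset) auto
  qed (use f(2)[of n] fin[of n] in auto)
  then show "real (card {u \<in> U n. \<not> P n (f n u)}) \<le> 1 * real (card {u \<in> U n. \<not> P n u})" by simp
qed

text \<open>The exceptional points of \<open>U n\<close> are those missed by \<open>p n\<close>, a
  vanishing fraction by \<open>lim\<close>, and the images of exceptional points of
  \<open>V n\<close>; each kind is allotted \<open>e / 2\<close>.\<close>

lemma almost_all_image:
  assumes fin: "\<And>n. finite (U n)" and P: "almost_all V P"
    and p: "\<And>n. inj_on (p n) (V n)" "\<And>n. p n ` V n \<subseteq> U n"
    and lim: "(\<lambda>n. real (card (V n)) / real (card (U n))) \<longlonglongrightarrow> 1"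
  shows "almost_all U (\<lambda>n u. \<exists>v\<in>V n. u = p n v \<and> P n v)"
  unfolding almost_all_def
proof (intro allI impI)
  fix e :: real assume "e > 0"
  then have "e / 2 > 0" by simp
  from lim have "\<forall>\<^sub>F n in sequentially. max 0 (1 - e / 2) < real (card (V n)) / real (card (U n))"
    using \<open>e > 0\<close> by (intro order_tendstoD) auto
  with P[unfolded almost_all_def, rule_format, OF \<open>e / 2 > 0\<close>]
  show "\<forall>\<^sub>F n in sequentially. real (card {u \<in> U n. \<not> (\<exists>v\<in>V n. u = p n v \<and> P n v)}) < e * real (card (U n))"
  proof eventually_elim
    case (elim n)
    then have pos: "card (U n) > 0" by (cases "card (U n) = 0") auto
    have card_p: "card (p n ` V n) = card (V n)" using p(1) by (rule card_image)
    have VU: "card (V n) \<le> card (U n)" using card_mono[OF fin p(2)] card_p by metis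
    have finV: "finite (V n)" using finite_imageD[OF finite_subset[OF p(2) fin] p(1)] .
    have "{u \<in> U n. \<not> (\<exists>v\<in>V n. u = p n v \<and> P n v)} \<subseteq> (U n - p n ` V n) \<union> p n ` {v \<in> V n. \<not> P n v}"
      by auto
    then have "card {u \<in> U n. \<not> (\<exists>v\<in>V n. u = p n v \<and> P n v)}
        \<le> card ((U n - p n ` V n) \<union> p n ` {v \<in> V n. \<not> P n v})"
      using fin finV by (intro card_mono) auto
    also have "\<dots> \<le> card (U n - p n ` V n) + card {v \<in> V n. \<not> P n v}"
      using finV by (intro order_trans[OF card_Un_le] add_left_mono card_image_le) auto
    also have "card (U n - p n ` V n) = card (U n) - card (V n)"
      using card_p p(2)[of n] finV by (subst card_Diff_subset) auto
    finally have *: "real (card {u \<in> U n. \<not> (\<exists>v\<in>V n. u = p n v \<and> P n v)})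
        \<le> real (card (U n)) - real (card (V n)) + real (card {v \<in> V n. \<not> P n v})"
      using VU by (simp add: of_nat_diff)
    have "(1 - e / 2) * real (card (U n)) < real (card (V n))"
      using elim(2) pos by (simp add: field_simps)
    then have **: "real (card (U n)) - real (card (V n)) < e / 2 * real (card (U n))"
      by (simp add: algebra_simps)
    have "real (card {v \<in> V n. \<not> P n v}) < e / 2 * real (card (U n))"
    proof (rule less_le_trans[OF elim(1)])
      show "e / 2 * real (card (V n)) \<le> e / 2 * real (card (U n))"
        using VU \<open>e > 0\<close> by (intro mult_left_mono) auto
    qed
    with * ** show ?case by linarith
  qed
qed

section \<open>The contradiction for genuine actions of H\<close>

text \<open>The count in \<open>card_not_growing_le\<close> becomes a density statement: almost
  everywhere \<open>\<tau>\<close> strictly lengthens the \<open>A\<close>-orbit, which an almost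
  everywhere involutive map cannot do twice in a row. The element \<open>h\<close> keeps almost all
  points away from the global fixed points of \<open>H\<close>.\<close>

lemma no_asymptotic_intertwiner:
  fixes H (structure) and c l :: real
  assumes action: "\<And>n. group_action H (U n) (\<phi> n)" and fin: "\<And>n. finite (U n)" "finite S"
    and A: "subgroup A H" and B: "subgroup B H" and S: "S \<subseteq> A" "\<omega> ` S \<subseteq> B" and "c > 0" "l > 1"
    and expander: "\<And>K. finite_index_subgroup K H \<Longrightarrow> expander c (Schreier (H\<lparr>carrier := A\<rparr>) (K \<inter> A) S)"
    and growth: "\<And>K. finite_index_subgroup K H \<Longrightarrow> K \<noteq> carrier H \<Longrightarrow>
      l * card {X \<in> lcosets K. X \<subseteq> B <#> (\<one> <#\<^bsub>H\<^esub> K)} \<le> card {X \<in> lcosets K. X \<subseteq> A <#> (\<one> <#\<^bsub>H\<^esub> K)}"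
    and \<tau>: "\<And>n. inj_on (\<tau> n) (U n)" "\<And>n. \<tau> n ` U n \<subseteq> U n"
    and involution: "almost_all U (\<lambda>n x. \<tau> n (\<tau> n x) = x)"
    and intertwine: "\<And>s. s \<in> S \<Longrightarrow> almost_all U (\<lambda>n x. \<tau> n (\<phi> n s x) = \<phi> n (\<omega> s) (\<tau> n x))"
    and "h \<in> carrier H" and free: "almost_all U (\<lambda>n x. \<phi> n h x \<noteq> x)"
  shows False
proof -
  define orb where "orb n = orbit (H\<lparr>carrier := A\<rparr>) (\<phi> n)" for n
  define k where "k = c * (1 - 1 / l)"
  have "k > 0" using \<open>c > 0\<close> \<open>l > 1\<close> by (simp add: k_def)
  have True: "almost_all U (\<lambda>_ _. True)"
    using fin(1) free by (rule almost_all_mono) auto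
  have "almost_all U (\<lambda>n x. \<forall>s\<in>S. \<tau> n (\<phi> n s x) = \<phi> n (\<omega> s) (\<tau> n x))"
    by (intro almost_all_Ball True fin intertwine)
  then have "almost_all U (\<lambda>n x. \<not> (\<not> card (orb n x) < card (orb n (\<tau> n x)) \<and>
      (\<exists>h\<in>carrier H. \<phi> n h (\<tau> n x) \<noteq> \<tau> n x)))"
  proof (rule almost_all_card_le[where C = "2 * card S / k"])
    fix n
    have "k * card {x \<in> U n. \<not> card (orb n x) < card (orb n (\<tau> n x)) \<and>
        (\<exists>h\<in>carrier H. \<phi> n h (\<tau> n x) \<noteq> \<tau> n x)}
      \<le> 2 * (card S * card {x \<in> U n. \<not> (\<forall>s\<in>S. \<tau> n (\<phi> n s x) = \<phi> n (\<omega> s) (\<tau> n x))})"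
      unfolding k_def orb_def
      by (rule card_not_growing_le[OF action fin A B S \<open>c > 0\<close> \<open>l > 1\<close> expander growth \<tau>])
    then show "real (card {x \<in> U n. \<not> \<not> (\<not> card (orb n x) < card (orb n (\<tau> n x)) \<and>
        (\<exists>h\<in>carrier H. \<phi> n h (\<tau> n x) \<noteq> \<tau> n x))})
      \<le> 2 * card S / k *
        real (card {x \<in> U n. \<not> (\<forall>s\<in>S. \<tau> n (\<phi> n s x) = \<phi> n (\<omega> s) (\<tau> n x))})"
      unfolding not_not using \<open>k > 0\<close> by (simp add: pos_le_divide_eq mult.commute)
  qed
  \<comment> \<open>Transporting the freeness of \<open>h\<close> along \<open>\<tau>\<close>
    disposes of the clause about points fixed by all of \<open>H\<close>.\<close>
  moreover have "almost_all U (\<lambda>n x. \<phi> n h (\<tau> n x) \<noteq> \<tau> n x)"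
    using almost_all_inj[OF fin(1) free \<tau>] by simp
  ultimately have "almost_all U (\<lambda>n x. \<not> (\<not> card (orb n x) < card (orb n (\<tau> n x)) \<and>
      (\<exists>h\<in>carrier H. \<phi> n h (\<tau> n x) \<noteq> \<tau> n x)) \<and> \<phi> n h (\<tau> n x) \<noteq> \<tau> n x)"
    by (rule almost_all_conj[OF fin(1)])
  then have less: "almost_all U (\<lambda>n x. card (orb n x) < card (orb n (\<tau> n x)))"
    by (rule almost_all_mono[OF fin(1)]) (use \<open>h \<in> carrier H\<close> in blast)
  then have "almost_all U (\<lambda>n x. card (orb n (\<tau> n x)) < card (orb n (\<tau> n (\<tau> n x))))"
    using almost_all_inj[OF fin(1) less \<tau>] by simp
  \<comment> \<open>One point satisfying all three conditions suffices: its \<open>A\<close>-orbit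
    would be longer than itself.\<close>
  note almost_all_nonempty[OF almost_all_conj[OF fin(1) less almost_all_conj[OF fin(1) this involution]]]
  then show False by fastforce
qed


section \<open>Embedding into the extension by an involution\<close>

definition fp_eval :: "('c, 'q) monoid_scheme \<Rightarrow> ('a \<Rightarrow> 'c) \<Rightarrow> ('b \<Rightarrow> 'c) \<Rightarrow> ('a + 'b) list \<Rightarrow> 'c" where
  "fp_eval Q f g w = foldr (\<lambda>z q. case_sum f g z \<otimes>\<^bsub>Q\<^esub> q) w \<one>\<^bsub>Q\<^esub>"

context
  fixes G :: "('a, 'm) monoid_scheme" and H :: "('b, 'n) monoid_scheme" and Q :: "('c, 'q) monoid_scheme"
    and f :: "'a \<Rightarrow> 'c" and g :: "'b \<Rightarrow> 'c"
  assumes groups: "group G" "group H" "group Q" and f: "f \<in> hom G Q" and g: "g \<in> hom H Q"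
begin

interpretation Q: group Q by fact

lemma fp_eval_closed: "w \<in> fp_words G H \<Longrightarrow> fp_eval Q f g w \<in> carrier Q"
  using hom_in_carrier[OF f] hom_in_carrier[OF g] by (induction w) (auto simp: fp_eval_def)

lemma fp_eval_append:
  "u \<in> fp_words G H \<Longrightarrow> v \<in> fp_words G H \<Longrightarrow>
    fp_eval Q f g (u @ v) = fp_eval Q f g u \<otimes>\<^bsub>Q\<^esub> fp_eval Q f g v"
proof (induction u)
  case Nil
  then show ?case using fp_eval_closed[of v] by (simp add: fp_eval_def)
next
  case (Cons z u)
  have z: "case_sum f g z \<in> carrier Q"
    using Cons.prems(1) hom_in_carrier[OF f] hom_in_carrier[OF g] by auto
  have cons: "fp_eval Q f g (z # w) = case_sum f g z \<otimes>\<^bsub>Q\<^esub> fp_eval Q f g w" for w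
    by (simp add: fp_eval_def)
  show ?case
    using Cons z fp_eval_closed[of u] fp_eval_closed[of v] by (simp add: cons Q.m_assoc)
qed

text \<open>It suffices to check the rules generating the relation: identities go to the identity,
  and \<open>f\<close> and \<open>g\<close> respect products.\<close>

lemma fp_eval_rel: "(u, v) \<in> fp_rel G H \<Longrightarrow> fp_eval Q f g u = fp_eval Q f g v"
proof (induction rule: fp_rel.induct)
  case (one_left u v)
  have "f \<one>\<^bsub>G\<^esub> = \<one>\<^bsub>Q\<^esub>" using f groups by (intro hom_one) auto
  moreover have "[Inl \<one>\<^bsub>G\<^esub>] @ v \<in> fp_words G H"
    using one_left groups(1) by (auto simp: group.is_monoid)
  ultimately show ?case
    using one_left fp_eval_append[of u "[Inl \<one>\<^bsub>G\<^esub>] @ v"] fp_eval_append[of u v] fp_eval_closed[of v]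
    by (simp add: fp_eval_def)
next
  case (one_right u v)
  have "g \<one>\<^bsub>H\<^esub> = \<one>\<^bsub>Q\<^esub>" using g groups by (intro hom_one) auto
  moreover have "[Inr \<one>\<^bsub>H\<^esub>] @ v \<in> fp_words G H"
    using one_right groups(2) by (auto simp: group.is_monoid)
  ultimately show ?case
    using one_right fp_eval_append[of u "[Inr \<one>\<^bsub>H\<^esub>] @ v"] fp_eval_append[of u v] fp_eval_closed[of v]
    by (simp add: fp_eval_def)
next
  case (mult_left u v x y)
  have w: "[Inl x, Inl y] @ v \<in> fp_words G H" "[Inl (x \<otimes>\<^bsub>G\<^esub> y)] @ v \<in> fp_words G H"
    using mult_left groups(1) by (auto simp: group.is_monoid monoid.m_closed)
  show ?case
    using mult_left fp_eval_append[OF mult_left(1) w(1)] fp_eval_append[OF mult_left(1) w(2)]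
      fp_eval_closed[of v] hom_in_carrier[OF f] hom_mult[OF f]
    by (simp add: fp_eval_def Q.m_assoc)
next
  case (mult_right u v x y)
  have w: "[Inr x, Inr y] @ v \<in> fp_words G H" "[Inr (x \<otimes>\<^bsub>H\<^esub> y)] @ v \<in> fp_words G H"
    using mult_right groups(2) by (auto simp: group.is_monoid monoid.m_closed)
  show ?case
    using mult_right fp_eval_append[OF mult_right(1) w(1)] fp_eval_append[OF mult_right(1) w(2)]
      fp_eval_closed[of v] hom_in_carrier[OF g] hom_mult[OF g]
    by (simp add: fp_eval_def Q.m_assoc)
qed auto

lemma free_product_lift:
  obtains F where "F \<in> hom (free_product G H) Q"
    and "\<And>x. x \<in> carrier G \<Longrightarrow> F (fp_inl G H x) = f x"
    and "\<And>y. y \<in> carrier H \<Longrightarrow> F (fp_inr G H y) = g y"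
proof
  let ?R = "fp_rel G H"
  \<comment> \<open>A class is evaluated at an arbitrary representative; \<open>fp_eval_rel\<close>
    makes the choice harmless.\<close>
  define F where "F X = fp_eval Q f g (SOME w. w \<in> X)" for X
  have F: "F (?R `` {u}) = fp_eval Q f g u" if "u \<in> fp_words G H" for u
  proof -
    have "u \<in> ?R `` {u}" using that fp_rel.refl by auto
    then have "(SOME w. w \<in> ?R `` {u}) \<in> ?R `` {u}" by (rule someI)
    then show ?thesis unfolding F_def using fp_eval_rel by auto
  qed
  show "F \<in> hom (free_product G H) Q"
  proof (rule homI)
    fix X assume "X \<in> carrier (free_product G H)"
    then obtain u where u: "u \<in> fp_words G H" "X = ?R `` {u}"
      unfolding free_product_def quotient_def by auto
    show "F X \<in> carrier Q" unfolding u(2) F[OF u(1)] using fp_eval_closed[OF u(1)] .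
    fix Y assume "Y \<in> carrier (free_product G H)"
    then obtain v where v: "v \<in> fp_words G H" "Y = ?R `` {v}"
      unfolding free_product_def quotient_def by auto
    have "u @ v \<in> fp_words G H" using u v by auto
    then show "F (X \<otimes>\<^bsub>free_product G H\<^esub> Y) = F X \<otimes>\<^bsub>Q\<^esub> F Y"
      unfolding u(2) v(2) fp_mult_class[OF groups(1,2) u(1) v(1)]
      by (simp add: F u(1) v(1) fp_eval_append)
  qed
  show "F (fp_inl G H x) = f x" if "x \<in> carrier G" for x
    unfolding fp_inl_def using that hom_in_carrier[OF f] by (subst F) (auto simp: fp_eval_def)
  show "F (fp_inr G H y) = g y" if "y \<in> carrier H" for y
    unfolding fp_inr_def using that hom_in_carrier[OF g] by (subst F) (auto simp: fp_eval_def)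
qed

end

text \<open>The kernel is itself a normal subgroup containing \<open>R\<close>, hence one of the
  sets intersected.\<close>

lemma normal_closure_subset_kernel:
  assumes "group P" "group Q" "F \<in> hom P Q" "R \<subseteq> kernel P Q F"
  shows "normal_closure P R \<subseteq> kernel P Q F"
  unfolding normal_closure_def
  using assms group_hom.normal_kernel[of P Q F] by (auto simp: group_hom_def group_hom_axioms_def)

section \<open>A permutation representation of the extension on H\<close>

text \<open>Cayley's regular representation; its faithfulness will give the injectivity of the
  embedding.\<close>

lemma hom_left_translation:
  assumes "group H"
  shows "(\<lambda>h. \<lambda>x\<in>carrier H. h \<otimes>\<^bsub>H\<^esub> x) \<in> hom H (BijGroup (carrier H))"
proof -
  interpret group H by fact
  have bij: "(\<lambda>x\<in>carrier H. h \<otimes>\<^bsub>H\<^esub> x) \<in> Bij (carrier H)" if "h \<in> carrier H" for h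
    unfolding Bij_def using that
    by (auto intro!: bij_betw_byWitness[of _ "\<lambda>x. inv\<^bsub>H\<^esub> h \<otimes>\<^bsub>H\<^esub> x"] simp: m_assoc[symmetric])
  show ?thesis
  proof (rule homI)
    fix h k assume h: "h \<in> carrier H" and k: "k \<in> carrier H"
    show "(\<lambda>x\<in>carrier H. h \<otimes>\<^bsub>H\<^esub> k \<otimes>\<^bsub>H\<^esub> x)
      = (\<lambda>x\<in>carrier H. h \<otimes>\<^bsub>H\<^esub> x) \<otimes>\<^bsub>BijGroup (carrier H)\<^esub> (\<lambda>x\<in>carrier H. k \<otimes>\<^bsub>H\<^esub> x)"
      using h k bij[OF h] bij[OF k] by (auto simp: BijGroup_def compose_def m_assoc restrict_def)
  qed (simp add: BijGroup_def bij)
qed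

text \<open>
  On each right coset \<open>C y\<close> the permutation sends \<open>c y\<close> to \<open>\<omega>(c) y\<close>, where \<open>y\<close> is the chosen
  representative.
\<close>

lemma coset_twist:
  fixes H (structure)
  assumes "group H" "subgroup C H"
    and hom: "\<omega> \<in> hom (H\<lparr>carrier := C\<rparr>) (H\<lparr>carrier := C\<rparr>)"
    and invol: "\<And>c. c \<in> C \<Longrightarrow> \<omega> (\<omega> c) = c"
  obtains T where "\<And>x. x \<in> carrier H \<Longrightarrow> T x \<in> carrier H"
    and "\<And>x. x \<in> carrier H \<Longrightarrow> T (T x) = x"
    and "\<And>c x. c \<in> C \<Longrightarrow> x \<in> carrier H \<Longrightarrow> T (c \<otimes> x) = \<omega> c \<otimes> T x"
proof -
  interpret group H by fact
  note C = subgroup.subset[OF assms(2)]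
  have \<omega>: "\<omega> c \<in> C" if "c \<in> C" for c using hom that by (auto simp: hom_def)
  have \<omega>_mult: "\<omega> (c \<otimes> d) = \<omega> c \<otimes> \<omega> d" if "c \<in> C" "d \<in> C" for c d
    using hom that by (auto simp: hom_def)
  define rep where "rep x = (SOME y. y \<in> C #> x)" for x
  \<comment> \<open>This is the component in \<open>C\<close>: \<open>x\<close> is
    \<open>d x\<close> times the representative of its right coset.\<close>
  define d where "d x = x \<otimes> inv (rep x)" for x
  define T where "T x = \<omega> (d x) \<otimes> rep x" for x
  have rep_mem: "rep x \<in> C #> x" if "x \<in> carrier H" for x
    unfolding rep_def using rcos_self[OF that assms(2)] by (rule someI)
  have rep: "rep x \<in> carrier H" if "x \<in> carrier H" for x
    using rep_mem[OF that] r_coset_subset_G[OF C that] by auto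
  have d: "d x \<in> C" if x: "x \<in> carrier H" for x
  proof -
    obtain c where c: "c \<in> C" "rep x = c \<otimes> x" using rep_mem[OF x] by (auto simp: r_coset_def)
    have "c \<in> carrier H" using c C by auto
    then have "d x = inv c"
      unfolding d_def c(2) using x by (simp add: inv_mult_group m_assoc[symmetric])
    then show ?thesis using c(1) assms(2) by (simp add: subgroup.m_inv_closed)
  qed
  have d_rep: "d x \<otimes> rep x = x" if "x \<in> carrier H" for x
    unfolding d_def using that rep[OF that] by (simp add: m_assoc)
  \<comment> \<open>The representative is chosen from the coset as a set, hence is constant on
    it.\<close>
  have rep_mult: "rep (c \<otimes> x) = rep x" if "c \<in> C" "x \<in> carrier H" for c x
    unfolding rep_def using repr_independence[OF rcosI[OF that(1) C that(2)] that(2) assms(2)] by simp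
  have d_mult: "d (c \<otimes> x) = c \<otimes> d x" if "c \<in> C" "x \<in> carrier H" for c x
    unfolding d_def rep_mult[OF that] using that rep C by (auto simp: m_assoc)
  \<comment> \<open>\<open>T x\<close> differs from \<open>x\<close> by the left factor
    \<open>\<omega> (d x)\<close> times the inverse of \<open>d x\<close>, which lies in
    \<open>C\<close>. So \<open>T\<close> keeps the representative and acts on the component in
    \<open>C\<close> as \<open>\<omega>\<close>, and it inherits being an involution from
    \<open>\<omega>\<close>.\<close>
  have rep_T: "rep (T x) = rep x" and d_T: "d (T x) = \<omega> (d x)" if x: "x \<in> carrier H" for x
  proof -
    have "T x = (\<omega> (d x) \<otimes> inv (d x)) \<otimes> x"
      using d_rep[OF x] d[OF x] \<omega>[OF d[OF x]] rep[OF x] x C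
      by (metis (no_types, lifting) T_def inv_closed inv_solve_left m_assoc subsetD)
    moreover have "\<omega> (d x) \<otimes> inv (d x) \<in> C"
      using d[OF x] \<omega> assms(2) by (simp add: subgroup.m_inv_closed subgroup.m_closed)
    ultimately show r: "rep (T x) = rep x" using rep_mult x by simp
    have "\<omega> (d x) \<in> carrier H" using \<omega> d x C by auto
    then show "d (T x) = \<omega> (d x)"
      unfolding d_def[of "T x"] r unfolding T_def using rep[OF x] by (simp add: m_assoc)
  qed
  show ?thesis
  proof
    fix x assume x: "x \<in> carrier H"
    show "T x \<in> carrier H" unfolding T_def using \<omega>[OF d[OF x]] rep[OF x] C by auto
    show "T (T x) = x"
      unfolding T_def[of "T x"] d_T[OF x] rep_T[OF x] using invol d_rep d x by simp
    fix c assume c: "c \<in> C"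
    show "T (c \<otimes> x) = \<omega> c \<otimes> T x"
      unfolding T_def d_mult[OF c x] rep_mult[OF c x] \<omega>_mult[OF c d[OF x]]
      using \<omega>[OF c] \<omega>[OF d[OF x]] rep[OF x] C by (auto intro!: m_assoc)
  qed
qed

text \<open>Turns the conjugation relators into commutation rules, the form in which they are
  checked for permutations and used for \<open>t\<close>.\<close>

lemma (in group) conj_relator_eq_one_iff:
  assumes "x \<in> carrier G" "y \<in> carrier G" "z \<in> carrier G"
  shows "x \<otimes> y \<otimes> inv x \<otimes> inv z = \<one> \<longleftrightarrow> x \<otimes> y = z \<otimes> x"
proof -
  have "x \<otimes> y \<otimes> inv x \<otimes> inv z = \<one> \<longleftrightarrow> x \<otimes> y \<otimes> inv x = z"
    using assms by (metis inv_closed inv_equality inv_inv m_closed r_inv)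
  also have "\<dots> \<longleftrightarrow> x \<otimes> y = z \<otimes> x"
    using assms by (metis inv_solve_right m_closed)
  finally show ?thesis .
qed

text \<open>Left translations and the twist \<open>T\<close> satisfy the defining relations, so the
  free product acts on \<open>H\<close> with the normal closure \<open>N\<close> acting trivially.
  An element of \<open>H\<close> that dies in \<open>G\<close> has its image in \<open>N\<close>,
  hence translates trivially and is the identity.\<close>

lemma adjoin_involution_embedding:
  fixes H :: "('a, 'm) monoid_scheme"
  assumes H: "group H" and A: "A \<subseteq> carrier H" and B: "B \<subseteq> carrier H"
    and aut: "\<omega> \<in> auto (H\<lparr>carrier := generate H (A \<union> B)\<rparr>)"
    and invol: "\<forall>x\<in>generate H (A \<union> B). \<omega> (\<omega> x) = x"
  defines "G \<equiv> adjoin_involution H A \<omega>"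
  obtains \<iota> t where "\<iota> \<in> hom H G" "inj_on \<iota> (carrier H)" "t \<in> carrier G" "t \<otimes>\<^bsub>G\<^esub> t = \<one>\<^bsub>G\<^esub>"
    and "\<And>a. a \<in> A \<Longrightarrow> t \<otimes>\<^bsub>G\<^esub> \<iota> a = \<iota> (\<omega> a) \<otimes>\<^bsub>G\<^esub> t"
proof -
  interpret H: group H by fact
  let ?C = "generate H (A \<union> B)" and ?P = "free_product H integer_group"
  let ?Q = "BijGroup (carrier H)"
  let ?i = "fp_inl H integer_group" and ?s = "fp_inr H integer_group 1"
  define R where "R = adjoin_relators H A \<omega>"
  define N where "N = normal_closure ?P R"
  define L where "L h = (\<lambda>x\<in>carrier H. h \<otimes>\<^bsub>H\<^esub> x)" for h
  interpret P: group ?P by (intro group_free_product H) simp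
  interpret Q: group ?Q by (rule group_BijGroup)
  have C: "subgroup ?C H" using A B by (intro H.generate_is_subgroup) auto
  have \<omega>_hom: "\<omega> \<in> hom (H\<lparr>carrier := ?C\<rparr>) (H\<lparr>carrier := ?C\<rparr>)"
    using aut by (simp add: auto_def)
  have AC: "A \<subseteq> ?C" by (auto intro: generate.incl)
  have \<omega>A: "\<omega> a \<in> carrier H" if "a \<in> A" for a
    using hom_in_carrier[OF \<omega>_hom, of a] that AC subgroup.subset[OF C] by auto
  have i: "?i \<in> hom H ?P" by (intro hom_fp_inl H) simp
  have ic: "?i h \<in> carrier ?P" if "h \<in> carrier H" for h using hom_in_carrier[OF i that] .
  have s: "?s \<in> carrier ?P"
    using hom_in_carrier[OF hom_fp_inr[OF H group_integer_group], of 1] by simp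
  have R: "R = insert (?s \<otimes>\<^bsub>?P\<^esub> ?s) {?s \<otimes>\<^bsub>?P\<^esub> ?i a \<otimes>\<^bsub>?P\<^esub> inv\<^bsub>?P\<^esub> ?s \<otimes>\<^bsub>?P\<^esub> inv\<^bsub>?P\<^esub> ?i (\<omega> a) | a. a \<in> A}"
    by (simp add: R_def adjoin_relators_def Let_def)
  have RP: "R \<subseteq> carrier ?P" unfolding R using s ic A \<omega>A by auto
  have N: "N \<lhd> ?P" unfolding N_def by (intro normal_normal_closure P.group_axioms RP)
  have RN: "R \<subseteq> N" unfolding N_def normal_closure_def by auto
  have G: "G = ?P Mod N" unfolding G_def N_def R_def adjoin_involution_def Let_def ..
  have "group G" unfolding G using N by (rule normal.factorgroup_is_group)
  then interpret G: group G .
  obtain T where T: "\<And>x. x \<in> carrier H \<Longrightarrow> T x \<in> carrier H"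
    "\<And>x. x \<in> carrier H \<Longrightarrow> T (T x) = x"
    "\<And>c x. c \<in> ?C \<Longrightarrow> x \<in> carrier H \<Longrightarrow> T (c \<otimes>\<^bsub>H\<^esub> x) = \<omega> c \<otimes>\<^bsub>H\<^esub> T x"
    using coset_twist[OF H C \<omega>_hom] invol by blast
  let ?T = "restrict T (carrier H)"
  have T_Bij: "?T \<in> Bij (carrier H)"
    unfolding Bij_def using T(1,2) by (auto intro!: bij_betw_byWitness[of _ T])
  then have T_Q: "?T \<in> carrier ?Q" by (simp add: BijGroup_def)
  have L: "L \<in> hom H ?Q" unfolding L_def using hom_left_translation[OF H] .
  have L_Q: "L h \<in> carrier ?Q" if "h \<in> carrier H" for h using hom_in_carrier[OF L that] .
  then have L_Bij: "L h \<in> Bij (carrier H)" if "h \<in> carrier H" for h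
    using that by (simp add: BijGroup_def)
  have TT: "?T \<otimes>\<^bsub>?Q\<^esub> ?T = \<one>\<^bsub>?Q\<^esub>"
    using T_Bij T by (auto simp: BijGroup_def compose_def restrict_def)
  have TL: "?T \<otimes>\<^bsub>?Q\<^esub> L a = L (\<omega> a) \<otimes>\<^bsub>?Q\<^esub> ?T" if "a \<in> A" for a
  proof -
    have "a \<in> ?C" "a \<in> carrier H" using that A AC by auto
    then show ?thesis
      using T_Bij L_Bij[of a] L_Bij[OF \<omega>A[OF that]] T
      by (auto simp: BijGroup_def compose_def L_def restrict_def)
  qed
  \<comment> \<open>The action of the free product on \<open>H\<close>; the integer \<open>n\<close>
    acts as the \<open>n\<close>-th power of the twist.\<close>
  obtain F where F: "F \<in> hom ?P ?Q"
    and Fi: "\<And>h. h \<in> carrier H \<Longrightarrow> F (?i h) = L h"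
    and Fs: "\<And>n. n \<in> carrier integer_group \<Longrightarrow> F (fp_inr H integer_group n) = ?T [^]\<^bsub>?Q\<^esub> n"
    using free_product_lift[OF H group_integer_group Q.group_axioms L Q.hom_integer_group_pow[OF T_Q]]
    by metis
  interpret F: group_hom ?P ?Q F
    using F by unfold_locales
  have Fs1: "F ?s = ?T" using Fs[of 1] T_Q by simp
  have "R \<subseteq> kernel ?P ?Q F"
  proof
    fix r assume r: "r \<in> R"
    then have rP: "r \<in> carrier ?P" using RP by auto
    consider "r = ?s \<otimes>\<^bsub>?P\<^esub> ?s"
      | a where "a \<in> A" "r = ?s \<otimes>\<^bsub>?P\<^esub> ?i a \<otimes>\<^bsub>?P\<^esub> inv\<^bsub>?P\<^esub> ?s \<otimes>\<^bsub>?P\<^esub> inv\<^bsub>?P\<^esub> ?i (\<omega> a)"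
      using r unfolding R by blast
    then have "F r = \<one>\<^bsub>?Q\<^esub>"
    proof cases
      case 1
      then show ?thesis using s Fs1 TT by simp
    next
      case (2 a)
      then have a: "a \<in> carrier H" using A by auto
      have "F r = ?T \<otimes>\<^bsub>?Q\<^esub> L a \<otimes>\<^bsub>?Q\<^esub> inv\<^bsub>?Q\<^esub> ?T \<otimes>\<^bsub>?Q\<^esub> inv\<^bsub>?Q\<^esub> L (\<omega> a)"
        using 2 a \<omega>A s ic Fi Fs1 by simp
      then show ?thesis
        using Q.conj_relator_eq_one_iff[OF T_Q L_Q[OF a] L_Q[OF \<omega>A[OF 2(1)]]] TL[OF 2(1)] by simp
    qed
    then show "r \<in> kernel ?P ?Q F" using rP by (simp add: kernel_def)
  qed
  then have NF: "N \<subseteq> kernel ?P ?Q F"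
    unfolding N_def by (intro normal_closure_subset_kernel P.group_axioms Q.group_axioms F)
  define \<pi> where "\<pi> x = N #>\<^bsub>?P\<^esub> x" for x
  have \<pi>: "\<pi> \<in> hom ?P G" unfolding G \<pi>_def using N by (rule normal.r_coset_hom_Mod)
  interpret \<pi>: group_hom ?P G \<pi> using \<pi> by unfold_locales
  have one_G: "\<one>\<^bsub>G\<^esub> = N" unfolding G FactGroup_def by simp
  have subN: "subgroup N ?P" using N by (rule normal_imp_subgroup)
  have \<pi>R: "\<pi> r = \<one>\<^bsub>G\<^esub>" if "r \<in> R" for r
    unfolding \<pi>_def one_G using that RN RP subN by (intro P.coset_join2) auto
  have \<pi>_ker: "x \<in> N" if "x \<in> carrier ?P" "\<pi> x = \<one>\<^bsub>G\<^esub>" for x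
    using that P.rcos_self[OF that(1) subN] unfolding \<pi>_def one_G by simp
  have \<iota>: "\<pi> \<circ> ?i \<in> hom H G" using i \<pi> by (rule hom_compose)
  interpret \<iota>: group_hom H G "\<pi> \<circ> ?i" using \<iota> by unfold_locales
  have "inj_on (\<pi> \<circ> ?i) (carrier H)"
  proof (rule \<iota>.trivial_ker_imp_inj)
    have "h = \<one>\<^bsub>H\<^esub>" if h: "h \<in> carrier H" "\<pi> (?i h) = \<one>\<^bsub>G\<^esub>" for h
    proof -
      have "F (?i h) = \<one>\<^bsub>?Q\<^esub>"
        using \<pi>_ker[OF ic[OF h(1)] h(2)] NF by (auto simp: kernel_def)
      \<comment> \<open>Evaluating the translation at the identity recovers
        \<open>h\<close>.\<close>
      then have "L h \<one>\<^bsub>H\<^esub> = \<one>\<^bsub>H\<^esub>" using Fi[OF h(1)] by (simp add: BijGroup_def)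
      then show ?thesis using h(1) by (simp add: L_def)
    qed
    then show "kernel H G (\<pi> \<circ> ?i) = {\<one>\<^bsub>H\<^esub>}"
      using \<iota>.hom_one by (auto simp: kernel_def)
  qed
  moreover have "\<pi> ?s \<in> carrier G" using s by simp
  moreover have "\<pi> ?s \<otimes>\<^bsub>G\<^esub> \<pi> ?s = \<one>\<^bsub>G\<^esub>"
    using \<pi>R[of "?s \<otimes>\<^bsub>?P\<^esub> ?s"] s by (simp add: R)
  moreover have "\<pi> ?s \<otimes>\<^bsub>G\<^esub> (\<pi> \<circ> ?i) a = (\<pi> \<circ> ?i) (\<omega> a) \<otimes>\<^bsub>G\<^esub> \<pi> ?s" if a: "a \<in> A" for a
  proof -
    have aH: "a \<in> carrier H" using a A by auto
    have "\<pi> (?s \<otimes>\<^bsub>?P\<^esub> ?i a \<otimes>\<^bsub>?P\<^esub> inv\<^bsub>?P\<^esub> ?s \<otimes>\<^bsub>?P\<^esub> inv\<^bsub>?P\<^esub> ?i (\<omega> a)) = \<one>\<^bsub>G\<^esub>"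
      using a by (intro \<pi>R) (auto simp: R)
    then show ?thesis
      using G.conj_relator_eq_one_iff[of "\<pi> ?s" "\<pi> (?i a)" "\<pi> (?i (\<omega> a))"] s ic[OF aH] ic[OF \<omega>A[OF a]]
      by simp
  qed
  ultimately show thesis using that \<iota> by blast
qed


section \<open>Pushing sofic approximations forward\<close>

lemma push_forward_apply:
  "inj_on p V \<Longrightarrow> p ` V \<subseteq> U \<Longrightarrow> v \<in> V \<Longrightarrow> push_forward V U p \<sigma> g (p v) = p (\<sigma> g v)"
  by (auto simp: push_forward_def)

lemma push_forward_outside:
  "u \<in> U \<Longrightarrow> u \<notin> p ` V \<Longrightarrow> push_forward V U p \<sigma> g u = u"
  by (simp add: push_forward_def)

lemma push_forward_Bij:
  assumes "inj_on p V" "p ` V \<subseteq> U" "\<sigma> g \<in> Bij V"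
  shows "push_forward V U p \<sigma> g \<in> Bij U"
proof -
  let ?f = "push_forward V U p \<sigma> g"
  have \<sigma>: "bij_betw (\<sigma> g) V V" using assms(3) by (simp add: Bij_def)
  have "bij_betw p V (p ` V)" using assms(1) by (simp add: bij_betw_def)
  from bij_betw_trans[OF bij_betw_trans[OF bij_betw_inv_into[OF this] \<sigma>] this]
  have "bij_betw ?f (p ` V) (p ` V)"
    by (rule bij_betw_cong[THEN iffD1, rotated]) (use assms(1,2) in \<open>auto simp: push_forward_apply\<close>)
  moreover have "bij_betw ?f (U - p ` V) (U - p ` V)"
    by (rule bij_betw_cong[THEN iffD1, rotated, OF bij_betw_id]) (simp add: push_forward_outside)
  ultimately have "bij_betw ?f (p ` V \<union> (U - p ` V)) (p ` V \<union> (U - p ` V))"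
    by (rule bij_betw_combine) auto
  moreover have "p ` V \<union> (U - p ` V) = U" using assms(2) by auto
  ultimately show ?thesis by (simp add: Bij_def push_forward_def)
qed

text \<open>Adding fixed points preserves multiplicativity, so a perfect approximation still gives
  genuine actions after being moved to the common sets of a conjugacy.\<close>

lemma push_forward_hom:
  assumes "inj_on p V" "p ` V \<subseteq> U" "\<sigma> \<in> hom G (BijGroup V)"
  shows "push_forward V U p \<sigma> \<in> hom G (BijGroup U)"
proof -
  have \<sigma>: "\<sigma> g \<in> Bij V" if "g \<in> carrier G" for g
    using hom_in_carrier[OF assms(3) that] by (simp add: BijGroup_def)
  have closed: "push_forward V U p \<sigma> g \<in> Bij U" if "g \<in> carrier G" for g
    using push_forward_Bij[of p V U \<sigma> g] assms(1,2) \<sigma>[OF that] by blast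
  show ?thesis
  proof (rule homI)
    fix g h assume gh: "g \<in> carrier G" "h \<in> carrier G"
    have mult: "\<sigma> (g \<otimes>\<^bsub>G\<^esub> h) v = \<sigma> g (\<sigma> h v)" if "v \<in> V" for v
      using hom_mult[OF assms(3) gh] \<sigma> gh that by (simp add: BijGroup_def compose_eq)
    have "push_forward V U p \<sigma> (g \<otimes>\<^bsub>G\<^esub> h) u
        = compose U (push_forward V U p \<sigma> g) (push_forward V U p \<sigma> h) u" for u
    proof (cases "u \<in> U")
      case True
      show ?thesis
      proof (cases "u \<in> p ` V")
        case image: True
        then obtain v where v: "v \<in> V" "u = p v" by auto
        have "\<sigma> h v \<in> V" using Bij_imp_funcset[OF \<sigma>[OF gh(2)]] v(1) by auto
        then show ?thesis
          using v True assms(1,2) mult by (simp add: compose_eq push_forward_apply)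
      qed (use True in \<open>simp add: compose_eq push_forward_outside\<close>)
    qed (simp add: push_forward_def compose_def)
    then show "push_forward V U p \<sigma> (g \<otimes>\<^bsub>G\<^esub> h)
        = push_forward V U p \<sigma> g \<otimes>\<^bsub>BijGroup U\<^esub> push_forward V U p \<sigma> h"
      using closed gh by (auto simp: BijGroup_def)
  qed (simp add: BijGroup_def closed)
qed

text \<open>Injectivity keeps nontrivial elements of \<open>H\<close> nontrivial in
  \<open>G\<close>, as the condition on fixed points requires.\<close>

lemma sofic_approximation_restrict:
  assumes "group H" "group G" "sofic_approximation G V \<sigma>" "\<iota> \<in> hom H G" "inj_on \<iota> (carrier H)"
  shows "sofic_approximation H V (\<lambda>n h. \<sigma> n (\<iota> h))"
proof -
  have \<iota>: "\<iota> h \<in> carrier G" if "h \<in> carrier H" for h using hom_in_carrier[OF assms(4) that] .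
  have "\<iota> h \<noteq> \<one>\<^bsub>G\<^esub>" if "h \<in> carrier H" "h \<noteq> \<one>\<^bsub>H\<^esub>" for h
    using that inj_onD[OF assms(5), of h "\<one>\<^bsub>H\<^esub>"] hom_one[OF assms(4,1,2)] group.is_monoid[OF assms(1)]
    by (metis monoid.one_closed)
  then show ?thesis
    using assms(3) \<iota> hom_mult[OF assms(4)] unfolding sofic_approximation_def by simp
qed

context
  fixes G :: "('g, 'm) monoid_scheme" and V :: "nat \<Rightarrow> 'v set" and \<sigma>
    and U :: "nat \<Rightarrow> 'u set" and p :: "nat \<Rightarrow> 'v \<Rightarrow> 'u"
  assumes sofic: "sofic_approximation G V \<sigma>" and finU: "\<And>n. finite (U n)"
    and p: "\<And>n. inj_on (p n) (V n)" "\<And>n. p n ` V n \<subseteq> U n"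
    and lim: "(\<lambda>n. real (card (V n)) / real (card (U n))) \<longlonglongrightarrow> 1"
begin

lemma almost_all_push_forward_mult:
  assumes gh: "g \<in> carrier G" "h \<in> carrier G"
  shows "almost_all U (\<lambda>n u. push_forward (V n) (U n) (p n) (\<sigma> n) g (push_forward (V n) (U n) (p n) (\<sigma> n) h u)
    = push_forward (V n) (U n) (p n) (\<sigma> n) (g \<otimes>\<^bsub>G\<^esub> h) u)"
proof -
  have finV: "finite (V n)" for n using sofic by (simp add: sofic_approximation_def)
  have "almost_all V (\<lambda>n v. \<sigma> n g (\<sigma> n h v) = \<sigma> n (g \<otimes>\<^bsub>G\<^esub> h) v)"
    by (rule almost_all_density_one[OF finV]) (use sofic gh in \<open>simp add: sofic_approximation_def\<close>)
  from almost_all_image[OF finU this p lim] show ?thesis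
  proof (rule almost_all_mono[OF finU])
    fix n u assume "\<exists>v\<in>V n. u = p n v \<and> \<sigma> n g (\<sigma> n h v) = \<sigma> n (g \<otimes>\<^bsub>G\<^esub> h) v"
    then obtain v where v: "v \<in> V n" "u = p n v" "\<sigma> n g (\<sigma> n h v) = \<sigma> n (g \<otimes>\<^bsub>G\<^esub> h) v" by auto
    have "\<sigma> n h \<in> Bij (V n)" using sofic gh by (simp add: sofic_approximation_def BijGroup_def)
    then have "\<sigma> n h v \<in> V n" using Bij_imp_funcset v(1) by blast
    then show "push_forward (V n) (U n) (p n) (\<sigma> n) g (push_forward (V n) (U n) (p n) (\<sigma> n) h u)
        = push_forward (V n) (U n) (p n) (\<sigma> n) (g \<otimes>\<^bsub>G\<^esub> h) u"
      using v p by (simp add: push_forward_apply)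
  qed
qed

lemma almost_all_push_forward_free:
  assumes g: "g \<in> carrier G" "g \<noteq> \<one>\<^bsub>G\<^esub>"
  shows "almost_all U (\<lambda>n u. push_forward (V n) (U n) (p n) (\<sigma> n) g u \<noteq> u)"
proof -
  have finV: "finite (V n)" for n using sofic by (simp add: sofic_approximation_def)
  \<comment> \<open>The multiplicativity limit serves here to show that \<open>V n\<close> is
    eventually nonempty, as \<open>almost_all_density_zero\<close> demands.\<close>
  have "almost_all V (\<lambda>n v. \<sigma> n g (\<sigma> n g v) = \<sigma> n (g \<otimes>\<^bsub>G\<^esub> g) v)"
    by (rule almost_all_density_one[OF finV]) (use sofic g in \<open>simp add: sofic_approximation_def\<close>)
  then have "almost_all V (\<lambda>_ _. True)"
    by (rule almost_all_mono[OF finV]) simp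
  then have "almost_all V (\<lambda>n v. \<not> \<sigma> n g v = v)"
    by (rule almost_all_density_zero) (use sofic g in \<open>simp add: sofic_approximation_def\<close>)
  from almost_all_image[OF finU this p lim] show ?thesis
  proof (rule almost_all_mono[OF finU])
    fix n u assume "\<exists>v\<in>V n. u = p n v \<and> \<not> \<sigma> n g v = v"
    then obtain v where v: "v \<in> V n" "u = p n v" "\<sigma> n g v \<noteq> v" by auto
    have "\<sigma> n g \<in> Bij (V n)" using sofic g by (simp add: sofic_approximation_def BijGroup_def)
    then have "\<sigma> n g v \<in> V n" using Bij_imp_funcset v(1) by blast
    then have "p n (\<sigma> n g v) \<noteq> p n v" using v inj_on_eq_iff[OF p(1)] by simp
    then show "push_forward (V n) (U n) (p n) (\<sigma> n) g u \<noteq> u"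
      using v p by (simp add: push_forward_apply)
  qed
qed

end

section \<open>Non-soficity of the extension\<close>

theorem theorem2p1:
  fixes H :: "('a, 'm) monoid_scheme"
    and A B :: "'a set"
    and \<omega> :: "'a \<Rightarrow> 'a"
  assumes "group H"
    and "countable (carrier H)"
    and nontrivial: "carrier H \<noteq> {\<one>\<^bsub>H\<^esub>}"
    and "flexibly_stable H"
    and "subgroup A H"
    and "subgroup B H"
    and orbits: "\<forall>K. finite_index_subgroup K H \<longrightarrow>
      (\<forall>h\<in>carrier H. B <#>\<^bsub>H\<^esub> (h <#\<^bsub>H\<^esub> K) \<subseteq> A <#>\<^bsub>H\<^esub> (h <#\<^bsub>H\<^esub> K))"
    and aut: "\<omega> \<in> auto (H\<lparr>carrier := generate H (A \<union> B)\<rparr>)"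
    and swap: "\<omega> ` A = B"
    and invol: "\<forall>x\<in>generate H (A \<union> B). \<omega> (\<omega> x) = x"
    and growth: "\<exists>l::real. l > 1 \<and>
      (\<forall>K. finite_index_subgroup K H \<and> K \<noteq> carrier H \<longrightarrow>
        (\<forall>g\<in>carrier H. \<forall>h\<in>carrier H.
          real (card {X \<in> lcosets\<^bsub>H\<^esub> K. X \<subseteq> A <#>\<^bsub>H\<^esub> (g <#\<^bsub>H\<^esub> K)})
            \<ge> l * real (card {X \<in> lcosets\<^bsub>H\<^esub> K. X \<subseteq> B <#>\<^bsub>H\<^esub> (h <#\<^bsub>H\<^esub> K)})))"
    and tau: "property_tau (H\<lparr>carrier := A\<rparr>) {K \<inter> A | K. finite_index_subgroup K H}"
  shows "\<not> sofic (adjoin_involution H A \<omega>)"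
proof
  let ?G = "adjoin_involution H A \<omega>"
  interpret H: group H by fact
  note A = subgroup.subset[OF \<open>subgroup A H\<close>] and B = subgroup.subset[OF \<open>subgroup B H\<close>]
  interpret G: group ?G
    using A B swap by (intro group_adjoin_involution \<open>group H\<close>) auto
  obtain \<iota> t where \<iota>: "\<iota> \<in> hom H ?G" "inj_on \<iota> (carrier H)" and t: "t \<in> carrier ?G"
    and tt: "t \<otimes>\<^bsub>?G\<^esub> t = \<one>\<^bsub>?G\<^esub>" and ta: "\<And>a. a \<in> A \<Longrightarrow> t \<otimes>\<^bsub>?G\<^esub> \<iota> a = \<iota> (\<omega> a) \<otimes>\<^bsub>?G\<^esub> t"
    by (rule adjoin_involution_embedding[OF \<open>group H\<close> A B aut invol]) blast
  have \<iota>_closed: "\<iota> h \<in> carrier ?G" if "h \<in> carrier H" for h using hom_in_carrier[OF \<iota>(1) that] .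
  assume "sofic ?G"
  then obtain V :: "nat \<Rightarrow> nat set" and \<sigma> where sofic: "sofic_approximation ?G V \<sigma>"
    unfolding sofic_def by auto
  obtain W :: "nat \<Rightarrow> nat set" and \<xi> where perfect: "perfect_sofic_approximation H W \<xi>"
    and conj: "conjugate H V (\<lambda>n h. \<sigma> n (\<iota> h)) W \<xi>"
    using \<open>flexibly_stable H\<close> sofic_approximation_restrict[OF \<open>group H\<close> G.group_axioms sofic \<iota>]
    unfolding flexibly_stable_def by blast
  obtain U :: "nat \<Rightarrow> nat set" and p r where U: "\<forall>n. finite (U n)"
      "\<forall>n. inj_on (p n) (V n) \<and> p n ` V n \<subseteq> U n" "\<forall>n. inj_on (r n) (W n) \<and> r n ` W n \<subseteq> U n"
    and lim: "(\<lambda>n. real (card (V n)) / real (card (U n))) \<longlonglongrightarrow> 1"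
    and edit: "edit_distance_zero H U (\<lambda>n. push_forward (V n) (U n) (p n) (\<lambda>h. \<sigma> n (\<iota> h)))
      (\<lambda>n. push_forward (W n) (U n) (r n) (\<xi> n))"
    using conj unfolding conjugate_def by (elim exE conjE) blast
  have finU: "finite (U n)" and p: "inj_on (p n) (V n)" "p n ` V n \<subseteq> U n"
    and r: "inj_on (r n) (W n)" "r n ` W n \<subseteq> U n" for n
    using U by auto
  \<comment> \<open>On the same sets \<open>U n\<close>, \<open>\<psi>\<close> is the approximate
    action of the extension and \<open>\<phi>\<close> the genuine action of \<open>H\<close>;
    \<open>\<psi> n t\<close> will play the role of \<open>\<tau>\<close>.\<close>
  define \<psi> where "\<psi> n = push_forward (V n) (U n) (p n) (\<sigma> n)" for n
  define \<phi> where "\<phi> n = push_forward (W n) (U n) (r n) (\<xi> n)" for n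
  note mult = almost_all_push_forward_mult[OF sofic finU p lim, folded \<psi>_def]
  note free = almost_all_push_forward_free[OF sofic finU p lim, folded \<psi>_def]
  have action: "group_action H (U n) (\<phi> n)" for n
  proof -
    have "\<phi> n \<in> hom H (BijGroup (U n))"
      unfolding \<phi>_def using perfect by (intro push_forward_hom r) (simp add: perfect_sofic_approximation_def)
    then show ?thesis
      using \<open>group H\<close> group_BijGroup
      by (auto simp: group_action_def group_hom_def group_hom_axioms_def)
  qed
  have agree: "almost_all U (\<lambda>n u. \<psi> n (\<iota> h) u = \<phi> n h u)" if "h \<in> carrier H" for h
  proof (rule almost_all_density_one[OF finU])
    have "push_forward (V n) (U n) (p n) (\<lambda>h. \<sigma> n (\<iota> h)) h = \<psi> n (\<iota> h)" for n
      by (simp add: \<psi>_def push_forward_def)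
    then show "(\<lambda>n. real (card {u \<in> U n. \<psi> n (\<iota> h) u = \<phi> n h u}) / real (card (U n))) \<longlonglongrightarrow> 1"
      using edit[unfolded edit_distance_zero_def, rule_format, OF that] by (simp only: \<phi>_def)
  qed
  have "\<psi> n t \<in> Bij (U n)" for n
    unfolding \<psi>_def using sofic t
    by (intro push_forward_Bij p) (simp add: sofic_approximation_def BijGroup_def)
  then have \<psi>t: "inj_on (\<psi> n t) (U n)" "\<psi> n t ` U n \<subseteq> U n" for n
    by (auto simp: Bij_def bij_betw_def)
  \<comment> \<open>A sofic approximation need not send the identity to the identity permutation;
    this holds almost everywhere by comparison with \<open>\<phi>\<close>.\<close>
  have involution: "almost_all U (\<lambda>n u. \<psi> n t (\<psi> n t u) = u)"
  proof -
    have "\<iota> \<one>\<^bsub>H\<^esub> = \<one>\<^bsub>?G\<^esub>" by (rule hom_one[OF \<iota>(1) \<open>group H\<close> G.group_axioms])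
    with almost_all_conj[OF finU mult[OF t t] agree[OF H.one_closed]]
    have *: "almost_all U (\<lambda>n u. \<psi> n t (\<psi> n t u) = \<psi> n \<one>\<^bsub>?G\<^esub> u \<and> \<psi> n \<one>\<^bsub>?G\<^esub> u = \<phi> n \<one>\<^bsub>H\<^esub> u)"
      by (simp add: tt)
    have "\<phi> n \<one>\<^bsub>H\<^esub> u = u" if "u \<in> U n" for n u
      using group_action.id_eq_one[OF action, of n] that by (metis restrict_apply')
    then show ?thesis by (intro almost_all_mono[OF finU *]) simp
  qed
  have intertwine: "almost_all U (\<lambda>n u. \<psi> n t (\<phi> n a u) = \<phi> n (\<omega> a) (\<psi> n t u))" if a: "a \<in> A" for a
  proof -
    have aH: "a \<in> carrier H" and \<omega>a: "\<omega> a \<in> carrier H" using a A B swap by auto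
    \<comment> \<open>Almost everywhere, replace \<open>\<phi> n a\<close> by
      \<open>\<psi> n (\<iota> a)\<close>, merge it with \<open>t\<close>, apply the relation
      \<open>ta\<close>, split again and return to \<open>\<phi>\<close>. The last replacement
      happens at \<open>\<psi> n t u\<close>, hence the transport along
      \<open>\<psi> n t\<close>.\<close>
    note almost_all_conj[OF finU agree[OF aH]
      almost_all_conj[OF finU mult[OF t \<iota>_closed[OF aH]]
        almost_all_conj[OF finU mult[OF \<iota>_closed[OF \<omega>a] t]
          almost_all_inj[OF finU agree[OF \<omega>a] \<psi>t]]]]
    then show ?thesis by (rule almost_all_mono[OF finU]) (auto simp: ta[OF a])
  qed
  define expanding where "expanding S c \<longleftrightarrow> (\<forall>L\<in>{K \<inter> A | K. finite_index_subgroup K H}.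
    expander c (Schreier (H\<lparr>carrier := A\<rparr>) L S))" for S c
  obtain S c where S: "finite S" "S \<subseteq> carrier (H\<lparr>carrier := A\<rparr>)" "c > 0" and "expanding S c"
    using tau[unfolded property_tau_def, folded expanding_def] by blast
  have SA: "S \<subseteq> A" using S(2) by simp
  have expander: "expander c (Schreier (H\<lparr>carrier := A\<rparr>) (K \<inter> A) S)" if "finite_index_subgroup K H" for K
    using \<open>expanding S c\<close> that unfolding expanding_def by blast
  define growing where "growing l \<longleftrightarrow> (\<forall>K. finite_index_subgroup K H \<and> K \<noteq> carrier H \<longrightarrow>
    (\<forall>g\<in>carrier H. \<forall>h\<in>carrier H.
      real (card {X \<in> lcosets\<^bsub>H\<^esub> K. X \<subseteq> A <#>\<^bsub>H\<^esub> (g <#\<^bsub>H\<^esub> K)})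
        \<ge> l * real (card {X \<in> lcosets\<^bsub>H\<^esub> K. X \<subseteq> B <#>\<^bsub>H\<^esub> (h <#\<^bsub>H\<^esub> K)})))" for l :: real
  obtain l where l: "l > 1" and "growing l"
    using growth[folded growing_def] by blast
  \<comment> \<open>Taking both coset representatives to be the identity suffices, since
    \<open>K\<close> will be the stabilizer of the very point whose two orbits are compared.\<close>
  have growth': "l * card {X \<in> lcosets\<^bsub>H\<^esub> K. X \<subseteq> B <#>\<^bsub>H\<^esub> (\<one>\<^bsub>H\<^esub> <#\<^bsub>H\<^esub> K)}
        \<le> card {X \<in> lcosets\<^bsub>H\<^esub> K. X \<subseteq> A <#>\<^bsub>H\<^esub> (\<one>\<^bsub>H\<^esub> <#\<^bsub>H\<^esub> K)}"
    if "finite_index_subgroup K H" "K \<noteq> carrier H" for K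
    using \<open>growing l\<close>[unfolded growing_def, rule_format, OF conjI, OF that H.one_closed H.one_closed] .
  \<comment> \<open>Nontriviality enters here: for trivial \<open>H\<close> the extension is cyclic
    of order two, which is sofic.\<close>
  obtain h where h: "h \<in> carrier H" "h \<noteq> \<one>\<^bsub>H\<^esub>" using nontrivial H.one_closed by blast
  have "\<iota> h \<noteq> \<one>\<^bsub>?G\<^esub>"
    using h inj_onD[OF \<iota>(2), of h "\<one>\<^bsub>H\<^esub>"] hom_one[OF \<iota>(1) \<open>group H\<close> G.group_axioms] by auto
  then have "almost_all U (\<lambda>n u. \<psi> n (\<iota> h) u \<noteq> u)" using h \<iota>_closed by (intro free) auto
  from almost_all_conj[OF finU this agree[OF h(1)]]
  have free_\<phi>: "almost_all U (\<lambda>n u. \<phi> n h u \<noteq> u)" by (rule almost_all_mono[OF finU]) auto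
  show False
  proof (rule no_asymptotic_intertwiner[OF action finU S(1) \<open>subgroup A H\<close> \<open>subgroup B H\<close> SA _ S(3) l
        expander growth' \<psi>t involution _ h(1) free_\<phi>])
    show "\<omega> ` S \<subseteq> B" using SA swap by auto
    show "almost_all U (\<lambda>n u. \<psi> n t (\<phi> n s u) = \<phi> n (\<omega> s) (\<psi> n t u))" if "s \<in> S" for s
      using intertwine SA that by auto
  qed
qed

end
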